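(* If a group $G$ acts chamber-freely on a $2$-Weyl graph $\mathcal W$ of type $M$, then the quotient $G\backslash\mathcal W$ is a $2$-Weyl graph, and the quotient map $\pi:\mathcal W\to G\backslash\mathcal W$ is a covering.
   Context: Setting. $M=(m_{st})_{s,t\in S}$ is a Coxeter matrix on a finite set $S$, and $W=\langle S\mid (st)^{m_{st}}=1,\ m_{st}<\infty\rangle$ is its Coxeter group. A word over $S$ is reduced if no shorter word represents the same element of $W$. For $s\ne t$ let $p_m(s,t)=stst\cdots$ ($m$ letters), and if $m_{st}<\infty$ let $p(s,t)=p_{m_{st}}(s,t)$. Groupoids are small and non-empty, with composition $g;h$ (or $gh$) written left to right, defined when $\tau(g)=\iota(h)$, where $\iota,\tau$ denote initial and terminal vertices. Weyl data. A generalized chamber system $\mathcal W$ of type $M$ is a set $\mathcal W_0$ of chambers with a family of groupoids $(\mathcal W_s)_{s\in S}$ (panel groupoids), each with vertex set $\mathcal W_0$. An edge of $\mathcal W$ of type $s$ is a non-identity edge of $\mathcal W_s$ (edges of different types are distinct). An $s$-panel is a connected component of $\mathcal W_s$. A gallery $\beta$ is a finite sequence of consecutive edges (a trivial gallery is a single chamber with no edges), with initial chamber $\iota(\beta)$, terminal chamber $\tau(\beta)$, type $\beta_S$ (the word of types of its edges), and $W$-length $\beta_W\in W$ (the element represented by $\beta_S$). It is a cycle if $\iota(\beta)=\tau(\beta)$, and a geodesic if $\beta_S$ is reduced. For $s\neq t$ with $m_{st}<\infty$: an $(s,t)$-geodesic is a geodesic of type $p_m(s,t)$ for some $m$; a maximal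 $(s,t)$-geodesic is a gallery of type $p(s,t)$; an $(s,t)$-cycle is a cycle of type $p_{2m_{st}}(s,t)$. An alternating geodesic is an $(s,t)$-geodesic for some $s,t$; trivial galleries and one-edge galleries count as alternating geodesics. Weyl data of type $M$ is a generalized chamber system of type $M$ together with, for each ordered pair $(s,t)$ with $s\neq t$, $m_{st}<\infty$, a set of $(s,t)$-cycles called defining suites. Homotopy. Elementary homotopies of galleries are the following moves on subgalleries and their inverses: delete $i\,i^{-1}$; replace $i\,i'$ ($i,i'$ of the same type, $i'\ne i^{-1}$) by the single edge $i;i'$; delete a defining suite. Galleries are homotopic ($\sim$) if related by finitely many such moves. A suite is an $(s,t)$-cycle homotopic to a trivial gallery. Morphisms and coverings. A morphism of generalized chamber systems of type $M$ is a map on chambers and edges preserving extremities, types and inverses, with $\omega(i;i')=\omega(i);\omega(i')$ whenever $i,i'$ are composable of the same type and $i'\neq i^{-1}$. A morphism of Weyl data is such a morphism sending defining suites to suites; isomorphisms are morphisms with inverse morphisms, automorphisms are self-isomorphisms. A morphism is surjective-étale if it is surjective on chambers and, for every chamber $C$, restricts to a bijection from the edges issuing from $C$ to the edges issuing from the image of $C$. A covering $p:\widetilde{\mathcal W}\to\mathcal W$ of Weyl data is a surjective-étale morphism of Weyl data such that every gallery $\beta$ of $\widetilde{\mathcal W}$ with $p\circ\beta$ a defining suite of $\mathcal W$ is a suite of $\widetilde{\mathcal W}$. A pre-Weyl graph is Weyl data satisfying (PW0) no panel is a trivial groupoid (one vertex, one edge), and (PW1) each maximal $(s,t)$-geodesic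 is homotopic to a maximal $(t,s)$-geodesic. A $2$-Weyl graph is a pre-Weyl graph satisfying (2W) homotopic alternating geodesics have the same $W$-length. Group actions and quotients. Groups act on Weyl data by automorphisms; the action is chamber-free if it is free on the set of chambers. For a chamber-free action of $G$ on $\mathcal W$, the quotient $G\backslash\mathcal W$ is the following Weyl data. Its chambers are the orbits $G\backslash\mathcal W_0$. Its panel groupoid of type $s$ is the quotient groupoid $G\backslash\mathcal W_s$: edges are $G$-orbits $[g]$ of edges of $\mathcal W_s$, with $\iota[g]=[\iota(g)]$, $\tau[g]=[\tau(g)]$, and $[g][g']=[gg'']$ for $g''\in[g']$ with $gg''$ defined. The quotient map $\pi$ sends chambers and edges to their orbits. The defining suites of $G\backslash\mathcal W$ are the galleries $\pi\circ\theta'$ with $\theta'$ a defining suite of $\mathcal W$. *)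

theory Defs
  imports "HOL-Library.Extended_Nat" "HOL-Algebra.Group_Action"
begin

section \<open>Group presentations and Coxeter groups\<close>

text \<open>Elements of the free group on \<open>S\<close> are written as signed words: \<open>(s, True)\<close> is the generator
  \<open>s\<close> and \<open>(s, False)\<close> is its inverse.\<close>

inductive presentation_step :: "'s set \<Rightarrow> ('s \<times> bool) list set \<Rightarrow> ('s \<times> bool) list \<Rightarrow> ('s \<times> bool) list \<Rightarrow> bool"
  for S R where
  cancel: "\<lbrakk>xs \<in> lists (S \<times> UNIV); ys \<in> lists (S \<times> UNIV); s \<in> S\<rbrakk>
    \<Longrightarrow> presentation_step S R (xs @ [(s, b), (s, \<not> b)] @ ys) (xs @ ys)"
| relator: "\<lbrakk>xs \<in> lists (S \<times> UNIV); ys \<in> lists (S \<times> UNIV); r \<in> R\<rbrakk>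
    \<Longrightarrow> presentation_step S R (xs @ r @ ys) (xs @ ys)"

definition presentation_rel :: "'s set \<Rightarrow> ('s \<times> bool) list set \<Rightarrow> (('s \<times> bool) list \<times> ('s \<times> bool) list) set" where
  "presentation_rel S R = {(u, v). u \<in> lists (S \<times> UNIV) \<and> v \<in> lists (S \<times> UNIV)
     \<and> equivclp (presentation_step S R) u v}"

definition presented_group :: "'s set \<Rightarrow> ('s \<times> bool) list set \<Rightarrow> ('s \<times> bool) list set monoid" where
  "presented_group S R =
    \<lparr>carrier = lists (S \<times> UNIV) // presentation_rel S R,
     mult = (\<lambda>A B. \<Union>x\<in>A. \<Union>y\<in>B. presentation_rel S R `` {x @ y}),
     one = presentation_rel S R `` {[]}\<rparr>"

lemma presentation_rel_refl: "u \<in> lists (S \<times> UNIV) \<Longrightarrow> (u, u) \<in> presentation_rel S R"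
  by (simp add: presentation_rel_def)

lemma presentation_rel_equiv: "equiv (lists (S \<times> UNIV)) (presentation_rel S R)"
  by (rule equivI)
     (auto simp: presentation_rel_def refl_on_def sym_def trans_def
        intro: equivclp_sym equivclp_trans)

lemma presentation_step_context:
  assumes "presentation_step S R u v" "a \<in> lists (S \<times> UNIV)" "b \<in> lists (S \<times> UNIV)"
  shows "presentation_step S R (a @ u @ b) (a @ v @ b)"
  using assms(1)
proof cases
  case (cancel xs ys s c)
  then show ?thesis
    using presentation_step.cancel[of "a @ xs" S "ys @ b" s R c] assms by simp
next
  case (relator xs ys r)
  then show ?thesis
    using presentation_step.relator[of "a @ xs" S "ys @ b" r R] assms by simp
qed

lemma presentation_equivclp_context:
  assumes "equivclp (presentation_step S R) u v" "a \<in> lists (S \<times> UNIV)" "b \<in> lists (S \<times> UNIV)"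
  shows "equivclp (presentation_step S R) (a @ u @ b) (a @ v @ b)"
  using assms(1)
proof (induction rule: equivclp_induct)
  case base
  show ?case by simp
next
  case (step y z)
  then have "equivclp (presentation_step S R) (a @ y @ b) (a @ z @ b)"
    using presentation_step_context[OF _ assms(2,3)] by (metis r_into_equivclp converse_r_into_equivclp)
  with step.IH show ?case by (rule equivclp_trans)
qed

lemma presentation_rel_append:
  assumes "(u, u') \<in> presentation_rel S R" "(v, v') \<in> presentation_rel S R"
  shows "(u @ v, u' @ v') \<in> presentation_rel S R"
proof -
  have uv: "u \<in> lists (S \<times> UNIV)" "u' \<in> lists (S \<times> UNIV)" "v \<in> lists (S \<times> UNIV)" "v' \<in> lists (S \<times> UNIV)"
    and e: "equivclp (presentation_step S R) u u'" "equivclp (presentation_step S R) v v'"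
    using assms by (auto simp: presentation_rel_def)
  have "equivclp (presentation_step S R) ([] @ u @ v) ([] @ u' @ v)"
    by (rule presentation_equivclp_context) (use uv e in auto)
  moreover have "equivclp (presentation_step S R) (u' @ v @ []) (u' @ v' @ [])"
    by (rule presentation_equivclp_context) (use uv e in auto)
  ultimately have "equivclp (presentation_step S R) (u @ v) (u' @ v')"
    by (simp add: equivclp_trans)
  with uv show ?thesis by (simp add: presentation_rel_def)
qed

lemma presented_group_mult:
  assumes "u \<in> lists (S \<times> UNIV)" "v \<in> lists (S \<times> UNIV)"
  shows "presentation_rel S R `` {u} \<otimes>\<^bsub>presented_group S R\<^esub> presentation_rel S R `` {v}
    = presentation_rel S R `` {u @ v}"
proof -
  have eq: "presentation_rel S R `` {x @ y} = presentation_rel S R `` {u @ v}"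
    if "x \<in> presentation_rel S R `` {u}" "y \<in> presentation_rel S R `` {v}" for x y
    using that equiv_class_eq[OF presentation_rel_equiv presentation_rel_append, of u x S R v y] by simp
  have ne: "u \<in> presentation_rel S R `` {u}" "v \<in> presentation_rel S R `` {v}"
    using assms presentation_rel_refl by auto
  have "(\<Union>x \<in> presentation_rel S R `` {u}. \<Union>y \<in> presentation_rel S R `` {v}. presentation_rel S R `` {x @ y})
    = (\<Union>x \<in> presentation_rel S R `` {u}. \<Union>y \<in> presentation_rel S R `` {v}. presentation_rel S R `` {u @ v})"
    by (intro SUP_cong refl eq)
  also have "\<dots> = presentation_rel S R `` {u @ v}" using ne by blast
  finally show ?thesis by (simp add: presented_group_def)
qed

lemma inverse_word_cancels:
  assumes "u \<in> lists (S \<times> UNIV)"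
  shows "(rev (map (\<lambda>(s, b). (s, \<not> b)) u) @ u, []) \<in> presentation_rel S R"
  using assms
proof (induction rule: lists.induct)
  case Nil
  show ?case using presentation_rel_refl[of "[]" S R] by simp
next
  case (Cons a u)
  obtain s b where a: "a = (s, b)" by (cases a)
  let ?v = "rev (map (\<lambda>(s, b). (s, \<not> b)) u)"
  have u: "u \<in> lists (S \<times> UNIV)" "s \<in> S"
    using Cons.hyps a by auto
  then have v: "?v \<in> lists (S \<times> UNIV)" by auto
  have "presentation_step S R (?v @ [(s, \<not> b), (s, \<not> \<not> b)] @ u) (?v @ u)"
    by (rule presentation_step.cancel) (use u v in auto)
  then have "equivclp (presentation_step S R) (?v @ [(s, \<not> b), (s, b)] @ u) (?v @ u)"
    by (simp add: r_into_equivclp)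
  moreover have "equivclp (presentation_step S R) (?v @ u) []"
    using Cons.IH u by (simp add: presentation_rel_def)
  ultimately have "equivclp (presentation_step S R) (?v @ [(s, \<not> b), (s, b)] @ u) []"
    by (rule equivclp_trans)
  then show ?case using u v by (simp add: presentation_rel_def a)
qed

lemma group_presented_group: "group (presented_group S R)"
proof -
  let ?G = "presented_group S R" and ?E = "presentation_rel S R"
  have carr: "carrier ?G = (\<lambda>u. ?E `` {u}) ` lists (S \<times> UNIV)"
    by (auto simp: presented_group_def quotient_def)
  have one: "\<one>\<^bsub>?G\<^esub> = ?E `` {[]}" by (simp add: presented_group_def)
  show ?thesis
  proof (rule groupI)
    fix x assume "x \<in> carrier ?G"
    then obtain u where u: "u \<in> lists (S \<times> UNIV)" "x = ?E `` {u}" by (auto simp: carr)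
    let ?v = "rev (map (\<lambda>(s, b). (s, \<not> b)) u)"
    have v: "?v \<in> lists (S \<times> UNIV)" using u by auto
    have "?E `` {?v} \<otimes>\<^bsub>?G\<^esub> x = \<one>\<^bsub>?G\<^esub>"
      using presented_group_mult[OF v u(1)] u one
        equiv_class_eq[OF presentation_rel_equiv inverse_word_cancels[OF u(1)]] by simp
    with v show "\<exists>y \<in> carrier ?G. y \<otimes>\<^bsub>?G\<^esub> x = \<one>\<^bsub>?G\<^esub>" by (auto simp: carr)
  next
    show "\<one>\<^bsub>?G\<^esub> \<in> carrier ?G" unfolding carr one by (rule imageI) simp
  next
    fix x assume "x \<in> carrier ?G"
    then obtain u where u: "u \<in> lists (S \<times> UNIV)" "x = ?E `` {u}" by (auto simp: carr)
    then show "\<one>\<^bsub>?G\<^esub> \<otimes>\<^bsub>?G\<^esub> x = x"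
      using presented_group_mult[of "[]" S u R] by (simp add: one)
  next
    fix x y assume "x \<in> carrier ?G" "y \<in> carrier ?G"
    then obtain u v where "u \<in> lists (S \<times> UNIV)" "x = ?E `` {u}" "v \<in> lists (S \<times> UNIV)" "y = ?E `` {v}"
      by (auto simp: carr)
    then show "x \<otimes>\<^bsub>?G\<^esub> y \<in> carrier ?G"
      unfolding carr by (simp add: presented_group_mult)
  next
    fix x y z assume "x \<in> carrier ?G" "y \<in> carrier ?G" "z \<in> carrier ?G"
    then obtain u v w where "u \<in> lists (S \<times> UNIV)" "x = ?E `` {u}" "v \<in> lists (S \<times> UNIV)" "y = ?E `` {v}"
      "w \<in> lists (S \<times> UNIV)" "z = ?E `` {w}"
      by (auto simp: carr)
    then show "x \<otimes>\<^bsub>?G\<^esub> y \<otimes>\<^bsub>?G\<^esub> z = x \<otimes>\<^bsub>?G\<^esub> (y \<otimes>\<^bsub>?G\<^esub> z)"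
      by (simp add: presented_group_mult)
  qed
qed

locale coxeter_matrix =
  fixes S :: "'s set" and m :: "'s \<Rightarrow> 's \<Rightarrow> enat"
  assumes finite_gens: "finite S"
    and diag: "s \<in> S \<Longrightarrow> m s s = 1"
    and symmetric: "\<lbrakk>s \<in> S; t \<in> S\<rbrakk> \<Longrightarrow> m s t = m t s"
    and off_diag: "\<lbrakk>s \<in> S; t \<in> S; s \<noteq> t\<rbrakk> \<Longrightarrow> 2 \<le> m s t"

definition coxeter_relators :: "'s set \<Rightarrow> ('s \<Rightarrow> 's \<Rightarrow> enat) \<Rightarrow> ('s \<times> bool) list set" where
  "coxeter_relators S m =
    {concat (replicate n [(s, True), (t, True)]) | s t n. s \<in> S \<and> t \<in> S \<and> m s t = enat n}"

definition coxeter_group :: "'s set \<Rightarrow> ('s \<Rightarrow> 's \<Rightarrow> enat) \<Rightarrow> ('s \<times> bool) list set monoid" where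
  "coxeter_group S m = presented_group S (coxeter_relators S m)"

definition word_elem :: "'s set \<Rightarrow> ('s \<Rightarrow> 's \<Rightarrow> enat) \<Rightarrow> 's list \<Rightarrow> ('s \<times> bool) list set" where
  "word_elem S m w = presentation_rel S (coxeter_relators S m) `` {map (\<lambda>s. (s, True)) w}"

lemma word_elem_append:
  assumes "v \<in> lists S" "w \<in> lists S"
  shows "word_elem S m (v @ w) = word_elem S m v \<otimes>\<^bsub>coxeter_group S m\<^esub> word_elem S m w"
proof -
  have "map (\<lambda>s. (s, True)) v \<in> lists (S \<times> UNIV)" "map (\<lambda>s. (s, True)) w \<in> lists (S \<times> UNIV)"
    using assms by auto
  then show ?thesis
    by (simp add: word_elem_def coxeter_group_def presented_group_mult)
qed

definition reduced_word :: "'s set \<Rightarrow> ('s \<Rightarrow> 's \<Rightarrow> enat) \<Rightarrow> 's list \<Rightarrow> bool" where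
  "reduced_word S m w \<longleftrightarrow> w \<in> lists S \<and>
    (\<forall>v \<in> lists S. word_elem S m v = word_elem S m w \<longrightarrow> length w \<le> length v)"

primrec alt_word :: "'s \<Rightarrow> 's \<Rightarrow> nat \<Rightarrow> 's list" where
  "alt_word s t 0 = []"
| "alt_word s t (Suc n) = s # alt_word t s n"

definition finite_pair :: "'s set \<Rightarrow> ('s \<Rightarrow> 's \<Rightarrow> enat) \<Rightarrow> 's \<Rightarrow> 's \<Rightarrow> bool" where
  "finite_pair S m s t \<longleftrightarrow> s \<in> S \<and> t \<in> S \<and> s \<noteq> t \<and> m s t \<noteq> \<infinity>"

section \<open>Groupoids\<close>

record ('v, 'e) groupoid_data =
  Vert :: "'v set"
  Arr :: "'e set"
  ini :: "'e \<Rightarrow> 'v"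
  ter :: "'e \<Rightarrow> 'v"
  gcomp :: "'e \<Rightarrow> 'e \<Rightarrow> 'e"
  gid :: "'v \<Rightarrow> 'e"
  ginv :: "'e \<Rightarrow> 'e"

text \<open>\<open>gcomp \<Gamma> g h\<close> is the left-to-right composite \<open>g;h\<close>, defined when \<open>ter \<Gamma> g = ini \<Gamma> h\<close>.\<close>

locale groupoid =
  fixes \<Gamma> :: "('v, 'e) groupoid_data"
  assumes nonempty: "Vert \<Gamma> \<noteq> {}"
    and ini_in: "g \<in> Arr \<Gamma> \<Longrightarrow> ini \<Gamma> g \<in> Vert \<Gamma>"
    and ter_in: "g \<in> Arr \<Gamma> \<Longrightarrow> ter \<Gamma> g \<in> Vert \<Gamma>"
    and comp_in: "\<lbrakk>g \<in> Arr \<Gamma>; h \<in> Arr \<Gamma>; ter \<Gamma> g = ini \<Gamma> h\<rbrakk> \<Longrightarrow> gcomp \<Gamma> g h \<in> Arr \<Gamma>"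
    and ini_comp: "\<lbrakk>g \<in> Arr \<Gamma>; h \<in> Arr \<Gamma>; ter \<Gamma> g = ini \<Gamma> h\<rbrakk> \<Longrightarrow> ini \<Gamma> (gcomp \<Gamma> g h) = ini \<Gamma> g"
    and ter_comp: "\<lbrakk>g \<in> Arr \<Gamma>; h \<in> Arr \<Gamma>; ter \<Gamma> g = ini \<Gamma> h\<rbrakk> \<Longrightarrow> ter \<Gamma> (gcomp \<Gamma> g h) = ter \<Gamma> h"
    and assoc: "\<lbrakk>g \<in> Arr \<Gamma>; h \<in> Arr \<Gamma>; k \<in> Arr \<Gamma>; ter \<Gamma> g = ini \<Gamma> h; ter \<Gamma> h = ini \<Gamma> k\<rbrakk>
      \<Longrightarrow> gcomp \<Gamma> (gcomp \<Gamma> g h) k = gcomp \<Gamma> g (gcomp \<Gamma> h k)"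
    and id_in: "v \<in> Vert \<Gamma> \<Longrightarrow> gid \<Gamma> v \<in> Arr \<Gamma>"
    and ini_id: "v \<in> Vert \<Gamma> \<Longrightarrow> ini \<Gamma> (gid \<Gamma> v) = v"
    and ter_id: "v \<in> Vert \<Gamma> \<Longrightarrow> ter \<Gamma> (gid \<Gamma> v) = v"
    and id_left: "g \<in> Arr \<Gamma> \<Longrightarrow> gcomp \<Gamma> (gid \<Gamma> (ini \<Gamma> g)) g = g"
    and id_right: "g \<in> Arr \<Gamma> \<Longrightarrow> gcomp \<Gamma> g (gid \<Gamma> (ter \<Gamma> g)) = g"
    and inv_in: "g \<in> Arr \<Gamma> \<Longrightarrow> ginv \<Gamma> g \<in> Arr \<Gamma>"
    and ini_inv: "g \<in> Arr \<Gamma> \<Longrightarrow> ini \<Gamma> (ginv \<Gamma> g) = ter \<Gamma> g"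
    and ter_inv: "g \<in> Arr \<Gamma> \<Longrightarrow> ter \<Gamma> (ginv \<Gamma> g) = ini \<Gamma> g"
    and inv_right: "g \<in> Arr \<Gamma> \<Longrightarrow> gcomp \<Gamma> g (ginv \<Gamma> g) = gid \<Gamma> (ini \<Gamma> g)"
    and inv_left: "g \<in> Arr \<Gamma> \<Longrightarrow> gcomp \<Gamma> (ginv \<Gamma> g) g = gid \<Gamma> (ter \<Gamma> g)"

definition groupoid_component :: "('v, 'e) groupoid_data \<Rightarrow> 'v \<Rightarrow> ('v, 'e) groupoid_data" where
  "groupoid_component \<Gamma> v =
    (let V = {u. \<exists>g \<in> Arr \<Gamma>. ini \<Gamma> g = v \<and> ter \<Gamma> g = u}
     in \<Gamma>\<lparr>Vert := V, Arr := {g \<in> Arr \<Gamma>. ini \<Gamma> g \<in> V}\<rparr>)"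

definition trivial_groupoid :: "('v, 'e) groupoid_data \<Rightarrow> bool" where
  "trivial_groupoid \<Gamma> \<longleftrightarrow> card (Vert \<Gamma>) = 1 \<and> card (Arr \<Gamma>) = 1"

section \<open>Generalized chamber systems, galleries and Weyl data\<close>

record ('s, 'c, 'e) chamber_system =
  chambers :: "'c set"
  panel_groupoid :: "'s \<Rightarrow> ('c, 'e) groupoid_data"

text \<open>An edge is tagged with its type, so that edges of different types are distinct. A gallery is
  its initial chamber together with its list of edges, so that trivial galleries are covered.\<close>

type_synonym ('s, 'c, 'e) gallery = "'c \<times> ('s \<times> 'e) list"

record ('s, 'c, 'e) weyl_struct = "('s, 'c, 'e) chamber_system" +
  defining_suites :: "'s \<Rightarrow> 's \<Rightarrow> ('s, 'c, 'e) gallery set"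

locale generalized_chamber_system = coxeter_matrix S m
  for S :: "'s set" and m :: "'s \<Rightarrow> 's \<Rightarrow> enat" +
  fixes \<W> :: "('s, 'c, 'e, 'z) chamber_system_scheme"
  assumes panel_groupoid: "s \<in> S \<Longrightarrow> groupoid (panel_groupoid \<W> s)"
    and panel_vertices: "s \<in> S \<Longrightarrow> Vert (panel_groupoid \<W> s) = chambers \<W>"

definition panels :: "('s, 'c, 'e, 'z) chamber_system_scheme \<Rightarrow> 's \<Rightarrow> ('c, 'e) groupoid_data set" where
  "panels \<W> s = groupoid_component (panel_groupoid \<W> s) ` chambers \<W>"

definition edges :: "'s set \<Rightarrow> ('s, 'c, 'e, 'z) chamber_system_scheme \<Rightarrow> ('s \<times> 'e) set" where
  "edges S \<W> = {(s, e). s \<in> S \<and> e \<in> Arr (panel_groupoid \<W> s)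
     \<and> e \<notin> gid (panel_groupoid \<W> s) ` Vert (panel_groupoid \<W> s)}"

definition edge_ini :: "('s, 'c, 'e, 'z) chamber_system_scheme \<Rightarrow> 's \<times> 'e \<Rightarrow> 'c" where
  "edge_ini \<W> i = ini (panel_groupoid \<W> (fst i)) (snd i)"

definition edge_ter :: "('s, 'c, 'e, 'z) chamber_system_scheme \<Rightarrow> 's \<times> 'e \<Rightarrow> 'c" where
  "edge_ter \<W> i = ter (panel_groupoid \<W> (fst i)) (snd i)"

definition edge_inv :: "('s, 'c, 'e, 'z) chamber_system_scheme \<Rightarrow> 's \<times> 'e \<Rightarrow> 's \<times> 'e" where
  "edge_inv \<W> i = (fst i, ginv (panel_groupoid \<W> (fst i)) (snd i))"

text \<open>Meaningful only for composable edges \<open>i\<close>, \<open>j\<close> of the same type.\<close>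
definition edge_comp :: "('s, 'c, 'e, 'z) chamber_system_scheme \<Rightarrow> 's \<times> 'e \<Rightarrow> 's \<times> 'e \<Rightarrow> 's \<times> 'e" where
  "edge_comp \<W> i j = (fst i, gcomp (panel_groupoid \<W> (fst i)) (snd i) (snd j))"

primrec edge_path :: "'s set \<Rightarrow> ('s, 'c, 'e, 'z) chamber_system_scheme \<Rightarrow> 'c \<Rightarrow> ('s \<times> 'e) list \<Rightarrow> bool" where
  "edge_path S \<W> c [] \<longleftrightarrow> c \<in> chambers \<W>"
| "edge_path S \<W> c (i # is) \<longleftrightarrow> i \<in> edges S \<W> \<and> edge_ini \<W> i = c \<and> edge_path S \<W> (edge_ter \<W> i) is"

definition gallery :: "'s set \<Rightarrow> ('s, 'c, 'e, 'z) chamber_system_scheme \<Rightarrow> ('s, 'c, 'e) gallery \<Rightarrow> bool" where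
  "gallery S \<W> \<beta> \<longleftrightarrow> edge_path S \<W> (fst \<beta>) (snd \<beta>)"

definition gallery_ini :: "('s, 'c, 'e) gallery \<Rightarrow> 'c" where
  "gallery_ini \<beta> = fst \<beta>"

definition gallery_ter :: "('s, 'c, 'e, 'z) chamber_system_scheme \<Rightarrow> ('s, 'c, 'e) gallery \<Rightarrow> 'c" where
  "gallery_ter \<W> \<beta> = (if snd \<beta> = [] then fst \<beta> else edge_ter \<W> (last (snd \<beta>)))"

definition gallery_type :: "('s, 'c, 'e) gallery \<Rightarrow> 's list" where
  "gallery_type \<beta> = map fst (snd \<beta>)"

definition W_length :: "'s set \<Rightarrow> ('s \<Rightarrow> 's \<Rightarrow> enat) \<Rightarrow> ('s, 'c, 'e) gallery \<Rightarrow> ('s \<times> bool) list set" where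
  "W_length S m \<beta> = word_elem S m (gallery_type \<beta>)"

definition gallery_cycle :: "'s set \<Rightarrow> ('s, 'c, 'e, 'z) chamber_system_scheme \<Rightarrow> ('s, 'c, 'e) gallery \<Rightarrow> bool" where
  "gallery_cycle S \<W> \<beta> \<longleftrightarrow> gallery S \<W> \<beta> \<and> gallery_ini \<beta> = gallery_ter \<W> \<beta>"

definition geodesic :: "'s set \<Rightarrow> ('s \<Rightarrow> 's \<Rightarrow> enat) \<Rightarrow> ('s, 'c, 'e, 'z) chamber_system_scheme
    \<Rightarrow> ('s, 'c, 'e) gallery \<Rightarrow> bool" where
  "geodesic S m \<W> \<beta> \<longleftrightarrow> gallery S \<W> \<beta> \<and> reduced_word S m (gallery_type \<beta>)"

definition st_geodesic :: "'s set \<Rightarrow> ('s \<Rightarrow> 's \<Rightarrow> enat) \<Rightarrow> ('s, 'c, 'e, 'z) chamber_system_scheme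
    \<Rightarrow> 's \<Rightarrow> 's \<Rightarrow> ('s, 'c, 'e) gallery \<Rightarrow> bool" where
  "st_geodesic S m \<W> s t \<beta> \<longleftrightarrow> finite_pair S m s t \<and> geodesic S m \<W> \<beta>
     \<and> (\<exists>n. gallery_type \<beta> = alt_word s t n)"

definition maximal_st_geodesic :: "'s set \<Rightarrow> ('s \<Rightarrow> 's \<Rightarrow> enat) \<Rightarrow> ('s, 'c, 'e, 'z) chamber_system_scheme
    \<Rightarrow> 's \<Rightarrow> 's \<Rightarrow> ('s, 'c, 'e) gallery \<Rightarrow> bool" where
  "maximal_st_geodesic S m \<W> s t \<beta> \<longleftrightarrow> finite_pair S m s t \<and> gallery S \<W> \<beta>
     \<and> gallery_type \<beta> = alt_word s t (the_enat (m s t))"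

definition st_cycle :: "'s set \<Rightarrow> ('s \<Rightarrow> 's \<Rightarrow> enat) \<Rightarrow> ('s, 'c, 'e, 'z) chamber_system_scheme
    \<Rightarrow> 's \<Rightarrow> 's \<Rightarrow> ('s, 'c, 'e) gallery \<Rightarrow> bool" where
  "st_cycle S m \<W> s t \<beta> \<longleftrightarrow> finite_pair S m s t \<and> gallery_cycle S \<W> \<beta>
     \<and> gallery_type \<beta> = alt_word s t (2 * the_enat (m s t))"

definition alternating_geodesic :: "'s set \<Rightarrow> ('s \<Rightarrow> 's \<Rightarrow> enat) \<Rightarrow> ('s, 'c, 'e, 'z) chamber_system_scheme
    \<Rightarrow> ('s, 'c, 'e) gallery \<Rightarrow> bool" where
  "alternating_geodesic S m \<W> \<beta> \<longleftrightarrow>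
     (\<exists>s t. st_geodesic S m \<W> s t \<beta>) \<or> (gallery S \<W> \<beta> \<and> length (snd \<beta>) \<le> 1)"

locale weyl_data = generalized_chamber_system S m \<W>
  for S :: "'s set" and m :: "'s \<Rightarrow> 's \<Rightarrow> enat" and \<W> :: "('s, 'c, 'e) weyl_struct" +
  assumes defining_suites_cycles:
    "\<lbrakk>finite_pair S m s t; \<theta> \<in> defining_suites \<W> s t\<rbrakk> \<Longrightarrow> st_cycle S m \<W> s t \<theta>"

text \<open>The field \<open>defining_suites\<close> is only consulted at pairs \<open>s \<noteq> t\<close> in \<open>S\<close> with \<open>m s t\<close> finite.\<close>
definition defining_suite :: "'s set \<Rightarrow> ('s \<Rightarrow> 's \<Rightarrow> enat) \<Rightarrow> ('s, 'c, 'e) weyl_struct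
    \<Rightarrow> ('s, 'c, 'e) gallery \<Rightarrow> bool" where
  "defining_suite S m \<W> \<theta> \<longleftrightarrow> (\<exists>s t. finite_pair S m s t \<and> \<theta> \<in> defining_suites \<W> s t)"

section \<open>Homotopy\<close>

inductive elementary_homotopy :: "'s set \<Rightarrow> ('s \<Rightarrow> 's \<Rightarrow> enat) \<Rightarrow> ('s, 'c, 'e) weyl_struct
    \<Rightarrow> ('s, 'c, 'e) gallery \<Rightarrow> ('s, 'c, 'e) gallery \<Rightarrow> bool"
  for S m \<W> where
  delete_inverse: "gallery S \<W> (c, xs @ [i, edge_inv \<W> i] @ ys)
    \<Longrightarrow> elementary_homotopy S m \<W> (c, xs @ [i, edge_inv \<W> i] @ ys) (c, xs @ ys)"
| compose_edges: "\<lbrakk>gallery S \<W> (c, xs @ [i, j] @ ys); fst i = fst j; j \<noteq> edge_inv \<W> i\<rbrakk>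
    \<Longrightarrow> elementary_homotopy S m \<W> (c, xs @ [i, j] @ ys) (c, xs @ [edge_comp \<W> i j] @ ys)"
| delete_suite: "\<lbrakk>gallery S \<W> (c, xs @ snd \<theta> @ ys); defining_suite S m \<W> \<theta>;
      gallery_ini \<theta> = gallery_ter \<W> (c, xs)\<rbrakk>
    \<Longrightarrow> elementary_homotopy S m \<W> (c, xs @ snd \<theta> @ ys) (c, xs @ ys)"

definition homotopic :: "'s set \<Rightarrow> ('s \<Rightarrow> 's \<Rightarrow> enat) \<Rightarrow> ('s, 'c, 'e) weyl_struct
    \<Rightarrow> ('s, 'c, 'e) gallery \<Rightarrow> ('s, 'c, 'e) gallery \<Rightarrow> bool" where
  "homotopic S m \<W> \<beta> \<gamma> \<longleftrightarrow> gallery S \<W> \<beta> \<and> gallery S \<W> \<gamma> \<and> equivclp (elementary_homotopy S m \<W>) \<beta> \<gamma>"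

definition suite :: "'s set \<Rightarrow> ('s \<Rightarrow> 's \<Rightarrow> enat) \<Rightarrow> ('s, 'c, 'e) weyl_struct \<Rightarrow> ('s, 'c, 'e) gallery \<Rightarrow> bool" where
  "suite S m \<W> \<theta> \<longleftrightarrow> (\<exists>s t. st_cycle S m \<W> s t \<theta>) \<and> (\<exists>c \<in> chambers \<W>. homotopic S m \<W> \<theta> (c, []))"

section \<open>Morphisms and coverings\<close>

text \<open>A morphism consists of a map \<open>f\<close> on chambers and a map \<open>f'\<close> on edges.\<close>

definition chamber_system_morphism :: "'s set \<Rightarrow> ('s, 'c, 'e, 'y) chamber_system_scheme
    \<Rightarrow> ('s, 'd, 'f, 'z) chamber_system_scheme \<Rightarrow> ('c \<Rightarrow> 'd) \<Rightarrow> ('s \<times> 'e \<Rightarrow> 's \<times> 'f) \<Rightarrow> bool" where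
  "chamber_system_morphism S \<V> \<W> f f' \<longleftrightarrow>
     (\<forall>c \<in> chambers \<V>. f c \<in> chambers \<W>) \<and>
     (\<forall>i \<in> edges S \<V>. f' i \<in> edges S \<W> \<and> fst (f' i) = fst i
        \<and> edge_ini \<W> (f' i) = f (edge_ini \<V> i) \<and> edge_ter \<W> (f' i) = f (edge_ter \<V> i)
        \<and> f' (edge_inv \<V> i) = edge_inv \<W> (f' i)) \<and>
     (\<forall>i \<in> edges S \<V>. \<forall>j \<in> edges S \<V>.
        fst i = fst j \<and> edge_ter \<V> i = edge_ini \<V> j \<and> j \<noteq> edge_inv \<V> i
        \<longrightarrow> f' (edge_comp \<V> i j) = edge_comp \<W> (f' i) (f' j))"

definition map_gallery :: "('c \<Rightarrow> 'd) \<Rightarrow> ('s \<times> 'e \<Rightarrow> 's \<times> 'f) \<Rightarrow> ('s, 'c, 'e) gallery \<Rightarrow> ('s, 'd, 'f) gallery" where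
  "map_gallery f f' \<beta> = (f (fst \<beta>), map f' (snd \<beta>))"

definition weyl_morphism :: "'s set \<Rightarrow> ('s \<Rightarrow> 's \<Rightarrow> enat) \<Rightarrow> ('s, 'c, 'e) weyl_struct
    \<Rightarrow> ('s, 'd, 'f) weyl_struct \<Rightarrow> ('c \<Rightarrow> 'd) \<Rightarrow> ('s \<times> 'e \<Rightarrow> 's \<times> 'f) \<Rightarrow> bool" where
  "weyl_morphism S m \<V> \<W> f f' \<longleftrightarrow> weyl_data S m \<V> \<and> weyl_data S m \<W>
     \<and> chamber_system_morphism S \<V> \<W> f f'
     \<and> (\<forall>\<theta>. defining_suite S m \<V> \<theta> \<longrightarrow> suite S m \<W> (map_gallery f f' \<theta>))"

definition weyl_isomorphism :: "'s set \<Rightarrow> ('s \<Rightarrow> 's \<Rightarrow> enat) \<Rightarrow> ('s, 'c, 'e) weyl_struct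
    \<Rightarrow> ('s, 'd, 'f) weyl_struct \<Rightarrow> ('c \<Rightarrow> 'd) \<Rightarrow> ('s \<times> 'e \<Rightarrow> 's \<times> 'f) \<Rightarrow> bool" where
  "weyl_isomorphism S m \<V> \<W> f f' \<longleftrightarrow> weyl_morphism S m \<V> \<W> f f' \<and>
     (\<exists>h h'. weyl_morphism S m \<W> \<V> h h'
        \<and> (\<forall>c \<in> chambers \<V>. h (f c) = c) \<and> (\<forall>i \<in> edges S \<V>. h' (f' i) = i)
        \<and> (\<forall>d \<in> chambers \<W>. f (h d) = d) \<and> (\<forall>j \<in> edges S \<W>. f' (h' j) = j))"

definition weyl_automorphism :: "'s set \<Rightarrow> ('s \<Rightarrow> 's \<Rightarrow> enat) \<Rightarrow> ('s, 'c, 'e) weyl_struct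
    \<Rightarrow> ('c \<Rightarrow> 'c) \<Rightarrow> ('s \<times> 'e \<Rightarrow> 's \<times> 'e) \<Rightarrow> bool" where
  "weyl_automorphism S m \<W> f f' \<longleftrightarrow> weyl_isomorphism S m \<W> \<W> f f'"

definition edges_from :: "'s set \<Rightarrow> ('s, 'c, 'e, 'z) chamber_system_scheme \<Rightarrow> 'c \<Rightarrow> ('s \<times> 'e) set" where
  "edges_from S \<W> c = {i \<in> edges S \<W>. edge_ini \<W> i = c}"

definition surjective_etale :: "'s set \<Rightarrow> ('s, 'c, 'e, 'y) chamber_system_scheme
    \<Rightarrow> ('s, 'd, 'f, 'z) chamber_system_scheme \<Rightarrow> ('c \<Rightarrow> 'd) \<Rightarrow> ('s \<times> 'e \<Rightarrow> 's \<times> 'f) \<Rightarrow> bool" where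
  "surjective_etale S \<V> \<W> f f' \<longleftrightarrow> chamber_system_morphism S \<V> \<W> f f'
     \<and> f ` chambers \<V> = chambers \<W>
     \<and> (\<forall>c \<in> chambers \<V>. bij_betw f' (edges_from S \<V> c) (edges_from S \<W> (f c)))"

definition weyl_covering :: "'s set \<Rightarrow> ('s \<Rightarrow> 's \<Rightarrow> enat) \<Rightarrow> ('s, 'c, 'e) weyl_struct
    \<Rightarrow> ('s, 'd, 'f) weyl_struct \<Rightarrow> ('c \<Rightarrow> 'd) \<Rightarrow> ('s \<times> 'e \<Rightarrow> 's \<times> 'f) \<Rightarrow> bool" where
  "weyl_covering S m \<V> \<W> p p' \<longleftrightarrow> weyl_morphism S m \<V> \<W> p p' \<and> surjective_etale S \<V> \<W> p p'
     \<and> (\<forall>\<beta>. gallery S \<V> \<beta> \<and> defining_suite S m \<W> (map_gallery p p' \<beta>) \<longrightarrow> suite S m \<V> \<beta>)"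

section \<open>2-Weyl graphs\<close>

locale pre_weyl_graph = weyl_data S m \<W>
  for S :: "'s set" and m :: "'s \<Rightarrow> 's \<Rightarrow> enat" and \<W> :: "('s, 'c, 'e) weyl_struct" +
  assumes PW0: "\<lbrakk>s \<in> S; P \<in> panels \<W> s\<rbrakk> \<Longrightarrow> \<not> trivial_groupoid P"
    and PW1: "maximal_st_geodesic S m \<W> s t \<beta>
      \<Longrightarrow> \<exists>\<gamma>. maximal_st_geodesic S m \<W> t s \<gamma> \<and> homotopic S m \<W> \<beta> \<gamma>"

locale two_weyl_graph = pre_weyl_graph S m \<W>
  for S :: "'s set" and m :: "'s \<Rightarrow> 's \<Rightarrow> enat" and \<W> :: "('s, 'c, 'e) weyl_struct" +
  assumes two_weyl: "\<lbrakk>alternating_geodesic S m \<W> \<beta>; alternating_geodesic S m \<W> \<gamma>; homotopic S m \<W> \<beta> \<gamma>\<rbrakk>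
    \<Longrightarrow> W_length S m \<beta> = W_length S m \<gamma>"

section \<open>Group actions and quotients\<close>

text \<open>An action of \<open>G\<close> on Weyl data is given by a left action \<open>\<phi>\<close> on chambers and a left action
  \<open>\<psi>\<close> on (non-identity) edges.\<close>

locale weyl_action =
  weyl_data S m \<W> + chamber_action: group_action G "chambers \<W>" \<phi> + edge_action: group_action G "edges S \<W>" \<psi>
  for G (structure) and S :: "'s set" and m :: "'s \<Rightarrow> 's \<Rightarrow> enat" and \<W> :: "('s, 'c, 'e) weyl_struct"
    and \<phi> :: "'g \<Rightarrow> 'c \<Rightarrow> 'c" and \<psi> :: "'g \<Rightarrow> 's \<times> 'e \<Rightarrow> 's \<times> 'e" +
  assumes automorphism: "g \<in> carrier G \<Longrightarrow> weyl_automorphism S m \<W> (\<phi> g) (\<psi> g)"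

definition chamber_free :: "('g, 'z) monoid_scheme \<Rightarrow> ('s, 'c, 'e) weyl_struct \<Rightarrow> ('g \<Rightarrow> 'c \<Rightarrow> 'c) \<Rightarrow> bool" where
  "chamber_free G \<W> \<phi> \<longleftrightarrow> (\<forall>g \<in> carrier G. \<forall>c \<in> chambers \<W>. \<phi> g c = c \<longrightarrow> g = \<one>\<^bsub>G\<^esub>)"

text \<open>The induced action on all edges of the panel groupoid of type \<open>s\<close>, including identities,
  which the edge action \<open>\<psi>\<close> does not cover.\<close>

definition panel_action :: "('s, 'c, 'e) weyl_struct \<Rightarrow> ('g \<Rightarrow> 'c \<Rightarrow> 'c) \<Rightarrow> ('g \<Rightarrow> 's \<times> 'e \<Rightarrow> 's \<times> 'e)
    \<Rightarrow> 's \<Rightarrow> 'g \<Rightarrow> 'e \<Rightarrow> 'e" where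
  "panel_action \<W> \<phi> \<psi> s g e =
     (let \<Gamma> = panel_groupoid \<W> s in
      if e \<in> gid \<Gamma> ` Vert \<Gamma> then gid \<Gamma> (\<phi> g (ini \<Gamma> e)) else snd (\<psi> g (s, e)))"

text \<open>Vertices and edges of the quotient groupoid are orbits. Since the action commutes with the
  structure maps, the orbit of \<open>\<iota>(g)\<close> is the image under \<open>\<iota>\<close> of the orbit of \<open>g\<close>, and similarly
  for \<open>\<tau>\<close>, identities and inverses. If the action is chamber-free, the orbit of \<open>g;g''\<close> consists of
  all composites of a member of \<open>[g]\<close> with a member of \<open>[g'']\<close>; see \<open>quotient_ini\<close>, \<open>quotient_ter\<close>
  and \<open>quotient_comp\<close> below.\<close>

definition quotient_groupoid :: "('g, 'z) monoid_scheme \<Rightarrow> ('g \<Rightarrow> 'v \<Rightarrow> 'v) \<Rightarrow> ('g \<Rightarrow> 'e \<Rightarrow> 'e)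
    \<Rightarrow> ('v, 'e) groupoid_data \<Rightarrow> ('v set, 'e set) groupoid_data" where
  "quotient_groupoid G \<phi> \<alpha> \<Gamma> =
    \<lparr>Vert = orbits G (Vert \<Gamma>) \<phi>,
     Arr = orbits G (Arr \<Gamma>) \<alpha>,
     ini = (\<lambda>A. ini \<Gamma> ` A),
     ter = (\<lambda>A. ter \<Gamma> ` A),
     gcomp = (\<lambda>A B. {gcomp \<Gamma> g h | g h. g \<in> A \<and> h \<in> B \<and> ter \<Gamma> g = ini \<Gamma> h}),
     gid = (\<lambda>V. gid \<Gamma> ` V),
     ginv = (\<lambda>A. ginv \<Gamma> ` A)\<rparr>"

definition quotient_chamber_map :: "('g, 'z) monoid_scheme \<Rightarrow> ('g \<Rightarrow> 'c \<Rightarrow> 'c) \<Rightarrow> 'c \<Rightarrow> 'c set" where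
  "quotient_chamber_map G \<phi> c = orbit G \<phi> c"

definition quotient_edge_map :: "('g, 'z) monoid_scheme \<Rightarrow> ('s, 'c, 'e) weyl_struct \<Rightarrow> ('g \<Rightarrow> 'c \<Rightarrow> 'c)
    \<Rightarrow> ('g \<Rightarrow> 's \<times> 'e \<Rightarrow> 's \<times> 'e) \<Rightarrow> 's \<times> 'e \<Rightarrow> 's \<times> 'e set" where
  "quotient_edge_map G \<W> \<phi> \<psi> i = (fst i, orbit G (panel_action \<W> \<phi> \<psi> (fst i)) (snd i))"

definition weyl_quotient :: "('g, 'z) monoid_scheme \<Rightarrow> ('s, 'c, 'e) weyl_struct \<Rightarrow> ('g \<Rightarrow> 'c \<Rightarrow> 'c)
    \<Rightarrow> ('g \<Rightarrow> 's \<times> 'e \<Rightarrow> 's \<times> 'e) \<Rightarrow> ('s, 'c set, 'e set) weyl_struct" where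
  "weyl_quotient G \<W> \<phi> \<psi> =
    \<lparr>chambers = orbits G (chambers \<W>) \<phi>,
     panel_groupoid = (\<lambda>s. quotient_groupoid G \<phi> (panel_action \<W> \<phi> \<psi> s) (panel_groupoid \<W> s)),
     defining_suites = (\<lambda>s t. map_gallery (quotient_chamber_map G \<phi>) (quotient_edge_map G \<W> \<phi> \<psi>)
                               ` defining_suites \<W> s t)\<rparr>"

context weyl_action
begin

lemma chamber_in: "g \<in> carrier G \<Longrightarrow> c \<in> chambers \<W> \<Longrightarrow> \<phi> g c \<in> chambers \<W>"
  using chamber_action.element_image by blast

lemma action_morphism: "g \<in> carrier G \<Longrightarrow> chamber_system_morphism S \<W> \<W> (\<phi> g) (\<psi> g)"
  using automorphism by (simp add: weyl_automorphism_def weyl_isomorphism_def weyl_morphism_def)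

lemma edge_action_props:
  assumes "g \<in> carrier G" "i \<in> edges S \<W>"
  shows "\<psi> g i \<in> edges S \<W>" "fst (\<psi> g i) = fst i"
    and "edge_ini \<W> (\<psi> g i) = \<phi> g (edge_ini \<W> i)" "edge_ter \<W> (\<psi> g i) = \<phi> g (edge_ter \<W> i)"
    and "\<psi> g (edge_inv \<W> i) = edge_inv \<W> (\<psi> g i)"
  using action_morphism[OF assms(1)] assms(2) unfolding chamber_system_morphism_def by blast+

lemma panel_action_props:
  assumes "s \<in> S" "g \<in> carrier G" "e \<in> Arr (panel_groupoid \<W> s)"
  shows "panel_action \<W> \<phi> \<psi> s g e \<in> Arr (panel_groupoid \<W> s)"
    and "ini (panel_groupoid \<W> s) (panel_action \<W> \<phi> \<psi> s g e) = \<phi> g (ini (panel_groupoid \<W> s) e)"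
    and "ter (panel_groupoid \<W> s) (panel_action \<W> \<phi> \<psi> s g e) = \<phi> g (ter (panel_groupoid \<W> s) e)"
proof -
  interpret P: groupoid "panel_groupoid \<W> s" using panel_groupoid assms(1) .
  let ?\<Gamma> = "panel_groupoid \<W> s" and ?a = "panel_action \<W> \<phi> \<psi> s g e"
  have V: "Vert ?\<Gamma> = chambers \<W>" using panel_vertices assms(1) .
  have "?a \<in> Arr ?\<Gamma> \<and> ini ?\<Gamma> ?a = \<phi> g (ini ?\<Gamma> e) \<and> ter ?\<Gamma> ?a = \<phi> g (ter ?\<Gamma> e)"
  proof (cases "e \<in> gid ?\<Gamma> ` Vert ?\<Gamma>")
    case True
    then obtain v where v: "v \<in> chambers \<W>" "e = gid ?\<Gamma> v" using V by auto
    then have "\<phi> g v \<in> chambers \<W>" using chamber_in assms by blast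
    with True v show ?thesis
      by (simp add: panel_action_def Let_def P.ini_id P.ter_id P.id_in V)
  next
    case False
    then have i: "(s, e) \<in> edges S \<W>" using assms by (simp add: edges_def)
    obtain e' where e': "\<psi> g (s, e) = (s, e')"
      using edge_action_props(2)[OF assms(2) i] by (metis fst_conv surjective_pairing)
    then have "?a = e'" using False by (simp add: panel_action_def Let_def)
    with edge_action_props[OF assms(2) i] e' show ?thesis
      by (simp add: edges_def edge_ini_def edge_ter_def)
  qed
  then show "?a \<in> Arr ?\<Gamma>" "ini ?\<Gamma> ?a = \<phi> g (ini ?\<Gamma> e)" "ter ?\<Gamma> ?a = \<phi> g (ter ?\<Gamma> e)" by auto
qed

lemma panel_action_id:
  assumes "s \<in> S" "g \<in> carrier G" "c \<in> chambers \<W>"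
  shows "panel_action \<W> \<phi> \<psi> s g (gid (panel_groupoid \<W> s) c) = gid (panel_groupoid \<W> s) (\<phi> g c)"
  using assms groupoid.ini_id[OF panel_groupoid[OF assms(1)], of c]
  by (simp add: panel_action_def Let_def panel_vertices)

lemma panel_action_nonid:
  assumes "(s, e) \<in> edges S \<W>" "g \<in> carrier G"
  shows "(s, panel_action \<W> \<phi> \<psi> s g e) = \<psi> g (s, e)"
  using edge_action_props(2)[OF assms(2,1)] assms(1)
  by (simp add: edges_def panel_action_def Let_def prod_eq_iff)

lemma panel_action_inv:
  assumes "s \<in> S" "g \<in> carrier G" "e \<in> Arr (panel_groupoid \<W> s)"
  shows "panel_action \<W> \<phi> \<psi> s g (ginv (panel_groupoid \<W> s) e)
    = ginv (panel_groupoid \<W> s) (panel_action \<W> \<phi> \<psi> s g e)"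
proof -
  interpret P: groupoid "panel_groupoid \<W> s" using panel_groupoid assms(1) .
  let ?\<Gamma> = "panel_groupoid \<W> s"
  have V: "Vert ?\<Gamma> = chambers \<W>" using panel_vertices assms(1) .
  have inv_id: "ginv ?\<Gamma> (gid ?\<Gamma> c) = gid ?\<Gamma> c" if "c \<in> chambers \<W>" for c
    using that P.id_left[of "ginv ?\<Gamma> (gid ?\<Gamma> c)"] P.inv_right[of "gid ?\<Gamma> c"]
    by (simp add: V P.id_in P.inv_in P.ini_inv P.ter_id P.ini_id)
  have inv_inv: "ginv ?\<Gamma> (ginv ?\<Gamma> e) = e"
  proof -
    have "ginv ?\<Gamma> (ginv ?\<Gamma> e) = gcomp ?\<Gamma> (gcomp ?\<Gamma> e (ginv ?\<Gamma> e)) (ginv ?\<Gamma> (ginv ?\<Gamma> e))"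
      using assms(3) P.id_left[of "ginv ?\<Gamma> (ginv ?\<Gamma> e)"]
      by (simp add: P.inv_right P.inv_in P.ini_inv P.ter_inv)
    also have "\<dots> = gcomp ?\<Gamma> e (gcomp ?\<Gamma> (ginv ?\<Gamma> e) (ginv ?\<Gamma> (ginv ?\<Gamma> e)))"
      using assms(3) by (intro P.assoc) (auto simp: P.inv_in P.ini_inv P.ter_inv)
    also have "\<dots> = e"
      using assms(3) by (simp add: P.inv_right P.inv_in P.ini_inv P.id_right)
    finally show ?thesis .
  qed
  show ?thesis
  proof (cases "e \<in> gid ?\<Gamma> ` Vert ?\<Gamma>")
    case True
    then obtain c where "c \<in> chambers \<W>" "e = gid ?\<Gamma> c" using V by auto
    then show ?thesis
      using assms chamber_in by (simp add: inv_id panel_action_id)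
  next
    case False
    then have i: "(s, e) \<in> edges S \<W>" using assms by (simp add: edges_def)
    have "ginv ?\<Gamma> e \<notin> gid ?\<Gamma> ` Vert ?\<Gamma>"
    proof
      assume "ginv ?\<Gamma> e \<in> gid ?\<Gamma> ` Vert ?\<Gamma>"
      then obtain c where "c \<in> chambers \<W>" "ginv ?\<Gamma> e = gid ?\<Gamma> c" using V by auto
      then have "e = gid ?\<Gamma> c" using inv_id[of c] inv_inv by simp
      with \<open>c \<in> chambers \<W>\<close> V False show False by blast
    qed
    then have j: "(s, ginv ?\<Gamma> e) \<in> edges S \<W>" using assms by (simp add: edges_def P.inv_in)
    have "\<psi> g (edge_inv \<W> (s, e)) = edge_inv \<W> (\<psi> g (s, e))"
      by (rule edge_action_props(5)[OF assms(2) i])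
    then have "(s, panel_action \<W> \<phi> \<psi> s g (ginv ?\<Gamma> e)) = edge_inv \<W> (s, panel_action \<W> \<phi> \<psi> s g e)"
      by (simp add: edge_inv_def panel_action_nonid[OF j assms(2)] panel_action_nonid[OF i assms(2)])
    then show ?thesis by (simp add: edge_inv_def)
  qed
qed

lemma panel_action_comp:
  assumes "s \<in> S" "g \<in> carrier G" "e \<in> Arr (panel_groupoid \<W> s)" "h \<in> Arr (panel_groupoid \<W> s)"
    and eh: "ter (panel_groupoid \<W> s) e = ini (panel_groupoid \<W> s) h"
  shows "panel_action \<W> \<phi> \<psi> s g (gcomp (panel_groupoid \<W> s) e h)
    = gcomp (panel_groupoid \<W> s) (panel_action \<W> \<phi> \<psi> s g e) (panel_action \<W> \<phi> \<psi> s g h)"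
proof -
  interpret P: groupoid "panel_groupoid \<W> s" using panel_groupoid assms(1) .
  let ?\<Gamma> = "panel_groupoid \<W> s" and ?a = "panel_action \<W> \<phi> \<psi> s g"
  have V: "Vert ?\<Gamma> = chambers \<W>" using panel_vertices assms(1) .
  note props = panel_action_props[OF assms(1,2)]
  consider "e \<in> gid ?\<Gamma> ` Vert ?\<Gamma>" | "h \<in> gid ?\<Gamma> ` Vert ?\<Gamma>" | "h = ginv ?\<Gamma> e"
    | "(s, e) \<in> edges S \<W>" "(s, h) \<in> edges S \<W>" "h \<noteq> ginv ?\<Gamma> e"
    using assms by (auto simp: edges_def)
  then show ?thesis
  proof cases
    case 1
    then obtain c where c: "c \<in> chambers \<W>" "e = gid ?\<Gamma> c" using V by auto
    then have "c = ini ?\<Gamma> h" using eh by (simp add: P.ter_id V)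
    then show ?thesis
      using c assms P.id_left[of h] P.id_left[of "?a h"] props[of h] by (simp add: panel_action_id)
  next
    case 2
    then obtain c where c: "c \<in> chambers \<W>" "h = gid ?\<Gamma> c" using V by auto
    then have "c = ter ?\<Gamma> e" using eh by (simp add: P.ini_id V)
    then show ?thesis
      using c assms P.id_right[of e] P.id_right[of "?a e"] props[of e] by (simp add: panel_action_id)
  next
    case 3
    then show ?thesis
      using assms props[of e] P.ini_in[of e]
      by (simp add: panel_action_inv P.inv_right panel_action_id V)
  next
    case 4
    have ne: "gcomp ?\<Gamma> e h \<notin> gid ?\<Gamma> ` Vert ?\<Gamma>"
    proof
      assume "gcomp ?\<Gamma> e h \<in> gid ?\<Gamma> ` Vert ?\<Gamma>"
      then obtain c where c: "c \<in> Vert ?\<Gamma>" "gcomp ?\<Gamma> e h = gid ?\<Gamma> c" by auto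
      then have ce: "c = ini ?\<Gamma> e" "c = ter ?\<Gamma> h"
        using assms P.ini_comp[of e h] P.ter_comp[of e h] by (simp_all add: P.ini_id P.ter_id)
      have "h = gcomp ?\<Gamma> (gcomp ?\<Gamma> (ginv ?\<Gamma> e) e) h"
        using assms P.id_left[of h] by (simp add: P.inv_left)
      also have "\<dots> = gcomp ?\<Gamma> (ginv ?\<Gamma> e) (gid ?\<Gamma> c)"
        using assms c by (subst P.assoc) (auto simp: P.inv_in P.ter_inv)
      also have "\<dots> = ginv ?\<Gamma> e"
        using assms ce P.id_right[of "ginv ?\<Gamma> e"] by (simp add: P.inv_in P.ter_inv)
      finally show False using 4 by simp
    qed
    then have k: "(s, gcomp ?\<Gamma> e h) \<in> edges S \<W>" using assms by (simp add: edges_def P.comp_in)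
    have "\<psi> g (edge_comp \<W> (s, e) (s, h)) = edge_comp \<W> (\<psi> g (s, e)) (\<psi> g (s, h))"
      using action_morphism[OF assms(2)] 4 eh
      by (auto simp: chamber_system_morphism_def edge_ini_def edge_ter_def edge_inv_def)
    then have "(s, ?a (gcomp ?\<Gamma> e h)) = edge_comp \<W> (s, ?a e) (s, ?a h)"
      by (simp add: edge_comp_def panel_action_nonid[OF k assms(2)] panel_action_nonid[OF 4(1) assms(2)]
          panel_action_nonid[OF 4(2) assms(2)])
    then show ?thesis by (simp add: edge_comp_def)
  qed
qed

lemma orbit_image: "orbit G \<alpha> x = (\<lambda>g. \<alpha> g x) ` carrier G"
  by (auto simp: orbit_def)

lemma quotient_ini:
  assumes "s \<in> S" "e \<in> Arr (panel_groupoid \<W> s)"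
  shows "ini (panel_groupoid (weyl_quotient G \<W> \<phi> \<psi>) s) (orbit G (panel_action \<W> \<phi> \<psi> s) e)
    = orbit G \<phi> (ini (panel_groupoid \<W> s) e)"
  using panel_action_props[OF assms(1) _ assms(2)]
  by (simp add: weyl_quotient_def quotient_groupoid_def orbit_image image_image)

lemma quotient_ter:
  assumes "s \<in> S" "e \<in> Arr (panel_groupoid \<W> s)"
  shows "ter (panel_groupoid (weyl_quotient G \<W> \<phi> \<psi>) s) (orbit G (panel_action \<W> \<phi> \<psi> s) e)
    = orbit G \<phi> (ter (panel_groupoid \<W> s) e)"
  using panel_action_props[OF assms(1) _ assms(2)]
  by (simp add: weyl_quotient_def quotient_groupoid_def orbit_image image_image)

lemma quotient_id:
  assumes "s \<in> S" "c \<in> chambers \<W>"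
  shows "gid (panel_groupoid (weyl_quotient G \<W> \<phi> \<psi>) s) (orbit G \<phi> c)
    = orbit G (panel_action \<W> \<phi> \<psi> s) (gid (panel_groupoid \<W> s) c)"
  using panel_action_id[OF assms(1) _ assms(2)]
  by (simp add: weyl_quotient_def quotient_groupoid_def orbit_image image_image)

lemma quotient_inv:
  assumes "s \<in> S" "e \<in> Arr (panel_groupoid \<W> s)"
  shows "ginv (panel_groupoid (weyl_quotient G \<W> \<phi> \<psi>) s) (orbit G (panel_action \<W> \<phi> \<psi> s) e)
    = orbit G (panel_action \<W> \<phi> \<psi> s) (ginv (panel_groupoid \<W> s) e)"
  using panel_action_inv[OF assms(1) _ assms(2)]
  by (simp add: weyl_quotient_def quotient_groupoid_def orbit_image image_image)

lemma chamber_free_unique: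
  assumes "chamber_free G \<W> \<phi>" "g \<in> carrier G" "k \<in> carrier G" "c \<in> chambers \<W>" "\<phi> g c = \<phi> k c"
  shows "g = k"
proof -
  interpret group G using chamber_action.group_hom group_hom.axioms(1) by blast
  have "\<phi> (inv k \<otimes> g) c = \<phi> (inv k) (\<phi> k c)"
    using assms by (simp add: chamber_action.composition_rule)
  also have "\<dots> = c" using chamber_action.orbit_sym_aux assms by blast
  finally have "inv k \<otimes> g = \<one>"
    using assms unfolding chamber_free_def by (meson inv_closed m_closed)
  then have "k \<otimes> (inv k \<otimes> g) = k" using assms by simp
  then show ?thesis using assms by (simp add: m_assoc[symmetric])
qed

lemma quotient_comp:
  assumes "chamber_free G \<W> \<phi>" "s \<in> S" "e \<in> Arr (panel_groupoid \<W> s)" "h \<in> Arr (panel_groupoid \<W> s)"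
    and eh: "ter (panel_groupoid \<W> s) e = ini (panel_groupoid \<W> s) h"
  shows "gcomp (panel_groupoid (weyl_quotient G \<W> \<phi> \<psi>) s)
      (orbit G (panel_action \<W> \<phi> \<psi> s) e) (orbit G (panel_action \<W> \<phi> \<psi> s) h)
    = orbit G (panel_action \<W> \<phi> \<psi> s) (gcomp (panel_groupoid \<W> s) e h)"
proof -
  interpret P: groupoid "panel_groupoid \<W> s" using panel_groupoid assms(2) .
  let ?\<Gamma> = "panel_groupoid \<W> s" and ?a = "panel_action \<W> \<phi> \<psi> s"
  have c: "ini ?\<Gamma> h \<in> chambers \<W>" using P.ini_in assms panel_vertices by blast
  have "ter ?\<Gamma> (?a g e) = ini ?\<Gamma> (?a k h) \<longleftrightarrow> g = k" if "g \<in> carrier G" "k \<in> carrier G" for g k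
    using that chamber_free_unique[OF assms(1) that c] assms by (auto simp: panel_action_props)
  then have "{gcomp ?\<Gamma> x y | x y. x \<in> orbit G ?a e \<and> y \<in> orbit G ?a h \<and> ter ?\<Gamma> x = ini ?\<Gamma> y}
    = {gcomp ?\<Gamma> (?a g e) (?a g h) | g. g \<in> carrier G}"
    unfolding orbit_def by blast
  also have "\<dots> = orbit G ?a (gcomp ?\<Gamma> e h)"
    unfolding orbit_image Setcompr_eq_image
    by (rule image_cong) (simp_all add: panel_action_comp[OF assms(2) _ assms(3-5)])
  finally show ?thesis by (simp add: weyl_quotient_def quotient_groupoid_def)
qed

end

end

theory Submission
  imports Defs
begin

text \<open>Morphisms of Weyl data preserve homotopy, and a covering lifts galleries uniquely (once the
  initial chamber is chosen) and lifts homotopies, because a lift of a defining suite is a suite.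
  Hence (PW0), (PW1) and (2W) all pass from a covering to its base: lift the galleries, apply the
  axiom upstairs, and project the result. The quotient map of a chamber-free action is a covering:
  freeness makes it bijective on the edges issuing from a chamber, and a lift of the image of a
  defining suite \<open>\<theta>\<close> is, by unique lifting, a translate of \<open>\<theta>\<close>, hence a suite.\<close>

section \<open>Galleries and homotopy\<close>

text \<open>Two mismatches shape the proof. Morphisms and coverings turn defining suites into suites
  only, so the deletion of an arbitrary suite must itself be a homotopy; this is why homotopies are
  first placed inside longer galleries. The group is given on chambers and on non-identity edges,
  whereas the quotient takes orbits of all arrows of the panel groupoids; hence
  \<open>panel_action\<close> has to be shown to behave like an action, treating identities and
  edges apart. Freeness also acts at a stage prior to the covering property: it makes the composites
  of two composable orbits a single orbit, and this is how the quotient panels inherit the groupoid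
  laws.\<close>

lemma gallery_ter_Nil [simp]: "gallery_ter \<W> (c, []) = c"
  by (simp add: gallery_ter_def)

text \<open>Replaces the definition through \<open>last\<close> by a recursion that moves the
  starting chamber along the list, the same recursion as in \<open>edge_path\<close>, so that
  inductions on the list of edges go through.\<close>

lemma gallery_ter_Cons [simp]: "gallery_ter \<W> (c, i # xs) = gallery_ter \<W> (edge_ter \<W> i, xs)"
  by (simp add: gallery_ter_def)

lemma gallery_ter_append:
  "gallery_ter \<W> (c, xs @ ys) = gallery_ter \<W> (gallery_ter \<W> (c, xs), ys)"
  by (induction xs arbitrary: c) auto

lemma edge_path_edges: "edge_path S \<W> c xs \<Longrightarrow> set xs \<subseteq> edges S \<W>"
  by (induction xs arbitrary: c) auto

section \<open>Paths, inverses and composites of edges\<close>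

context generalized_chamber_system
begin

lemma edge_ini_in: "i \<in> edges S \<W> \<Longrightarrow> edge_ini \<W> i \<in> chambers \<W>"
  and edge_ter_in: "i \<in> edges S \<W> \<Longrightarrow> edge_ter \<W> i \<in> chambers \<W>"
  using groupoid.ini_in[OF panel_groupoid] groupoid.ter_in[OF panel_groupoid] panel_vertices
  by (fastforce simp: edges_def edge_ini_def edge_ter_def)+

lemma edge_path_start: "edge_path S \<W> c xs \<Longrightarrow> c \<in> chambers \<W>"
  by (cases xs) (auto simp: edge_ini_in)

lemma edge_path_append:
  "edge_path S \<W> c (xs @ ys) \<longleftrightarrow>
    edge_path S \<W> c xs \<and> edge_path S \<W> (gallery_ter \<W> (c, xs)) ys"
  by (induction xs arbitrary: c) (auto dest: edge_path_start)

lemma ginv_gid: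
  assumes "s \<in> S" "c \<in> chambers \<W>"
  shows "ginv (panel_groupoid \<W> s) (gid (panel_groupoid \<W> s) c) = gid (panel_groupoid \<W> s) c"
proof -
  interpret P: groupoid "panel_groupoid \<W> s" using panel_groupoid assms(1) .
  have "c \<in> Vert (panel_groupoid \<W> s)" using panel_vertices assms by simp
  then show ?thesis
    using P.id_left[of "ginv (panel_groupoid \<W> s) (gid (panel_groupoid \<W> s) c)"]
      P.inv_right[of "gid (panel_groupoid \<W> s) c"]
    by (simp add: P.id_in P.inv_in P.ini_inv P.ter_id P.ini_id)
qed

lemma ginv_ginv:
  assumes "s \<in> S" "e \<in> Arr (panel_groupoid \<W> s)"
  shows "ginv (panel_groupoid \<W> s) (ginv (panel_groupoid \<W> s) e) = e"
proof -
  interpret P: groupoid "panel_groupoid \<W> s" using panel_groupoid assms(1) .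
  let ?\<Gamma> = "panel_groupoid \<W> s"
  have "ginv ?\<Gamma> (ginv ?\<Gamma> e) = gcomp ?\<Gamma> (gcomp ?\<Gamma> e (ginv ?\<Gamma> e)) (ginv ?\<Gamma> (ginv ?\<Gamma> e))"
    using assms(2) P.id_left[of "ginv ?\<Gamma> (ginv ?\<Gamma> e)"]
    by (simp add: P.inv_right P.inv_in P.ini_inv P.ter_inv)
  also have "\<dots> = gcomp ?\<Gamma> e (gcomp ?\<Gamma> (ginv ?\<Gamma> e) (ginv ?\<Gamma> (ginv ?\<Gamma> e)))"
    using assms(2) by (intro P.assoc) (auto simp: P.inv_in P.ini_inv P.ter_inv)
  also have "\<dots> = e"
    using assms(2) by (simp add: P.inv_right P.inv_in P.ini_inv P.id_right)
  finally show ?thesis .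
qed

text \<open>Inversion is an involution fixing the identities, so it cannot send a non-identity arrow
  to an identity.\<close>

lemma edge_inv_props:
  assumes "i \<in> edges S \<W>"
  shows "edge_inv \<W> i \<in> edges S \<W>" "edge_ini \<W> (edge_inv \<W> i) = edge_ter \<W> i"
    "edge_ter \<W> (edge_inv \<W> i) = edge_ini \<W> i"
proof -
  obtain s e where i: "i = (s, e)" "s \<in> S" "e \<in> Arr (panel_groupoid \<W> s)"
    "e \<notin> gid (panel_groupoid \<W> s) ` Vert (panel_groupoid \<W> s)"
    using assms by (auto simp: edges_def)
  interpret P: groupoid "panel_groupoid \<W> s" using panel_groupoid i(2) .
  show "edge_inv \<W> i \<in> edges S \<W>"
    using i P.inv_in ginv_ginv[of s e] ginv_gid[of s] panel_vertices[of s]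
    by (auto simp: edges_def edge_inv_def image_iff)
  show "edge_ini \<W> (edge_inv \<W> i) = edge_ter \<W> i" "edge_ter \<W> (edge_inv \<W> i) = edge_ini \<W> i"
    using i by (auto simp: edge_ini_def edge_ter_def edge_inv_def P.ini_inv P.ter_inv)
qed

text \<open>The third claim explains the side condition of \<open>compose_edges\<close>: it excludes
  exactly the case in which the composite is an identity, which would not be an edge. Both morphisms
  and homotopies rely on this equivalence.\<close>

lemma edge_comp_props:
  assumes "i \<in> edges S \<W>" "j \<in> edges S \<W>" "fst i = fst j" "edge_ter \<W> i = edge_ini \<W> j"
  shows "edge_ini \<W> (edge_comp \<W> i j) = edge_ini \<W> i"
    "edge_ter \<W> (edge_comp \<W> i j) = edge_ter \<W> j"
    "edge_comp \<W> i j \<in> edges S \<W> \<longleftrightarrow> j \<noteq> edge_inv \<W> i"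
proof -
  obtain s e where i: "i = (s, e)" "s \<in> S" "e \<in> Arr (panel_groupoid \<W> s)"
    using assms by (auto simp: edges_def)
  obtain h where j: "j = (s, h)" "h \<in> Arr (panel_groupoid \<W> s)"
    using assms i by (cases j) (auto simp: edges_def)
  interpret P: groupoid "panel_groupoid \<W> s" using panel_groupoid i(2) .
  let ?\<Gamma> = "panel_groupoid \<W> s"
  have eh: "ter ?\<Gamma> e = ini ?\<Gamma> h" using assms(4) i j by (simp add: edge_ini_def edge_ter_def)
  show "edge_ini \<W> (edge_comp \<W> i j) = edge_ini \<W> i" "edge_ter \<W> (edge_comp \<W> i j) = edge_ter \<W> j"
    using i j eh by (simp_all add: edge_ini_def edge_ter_def edge_comp_def P.ini_comp P.ter_comp)
  have "gcomp ?\<Gamma> e h \<in> gid ?\<Gamma> ` Vert ?\<Gamma> \<longleftrightarrow> h = ginv ?\<Gamma> e"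
  proof
    assume "gcomp ?\<Gamma> e h \<in> gid ?\<Gamma> ` Vert ?\<Gamma>"
    then obtain c where c: "c \<in> Vert ?\<Gamma>" "gcomp ?\<Gamma> e h = gid ?\<Gamma> c" by auto
    then have ce: "c = ini ?\<Gamma> e" "c = ter ?\<Gamma> h"
      using i j eh P.ini_comp[of e h] P.ter_comp[of e h] by (simp_all add: P.ini_id P.ter_id)
    \<comment> \<open>Left cancellation: \<open>e;h\<close> is an identity, so multiplying by the
      inverse of \<open>e\<close> on the left recovers \<open>h\<close>.\<close>
    have "h = gcomp ?\<Gamma> (gcomp ?\<Gamma> (ginv ?\<Gamma> e) e) h"
      using i j eh P.id_left[of h] by (simp add: P.inv_left)
    also have "\<dots> = gcomp ?\<Gamma> (ginv ?\<Gamma> e) (gid ?\<Gamma> c)"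
      using i j eh c by (subst P.assoc) (auto simp: P.inv_in P.ter_inv)
    also have "\<dots> = ginv ?\<Gamma> e"
      using i j ce P.id_right[of "ginv ?\<Gamma> e"] by (simp add: P.inv_in P.ter_inv)
    finally show "h = ginv ?\<Gamma> e" .
  next
    assume "h = ginv ?\<Gamma> e"
    then show "gcomp ?\<Gamma> e h \<in> gid ?\<Gamma> ` Vert ?\<Gamma>"
      using i P.inv_right P.ini_in by auto
  qed
  then show "edge_comp \<W> i j \<in> edges S \<W> \<longleftrightarrow> j \<noteq> edge_inv \<W> i"
    using i j eh by (auto simp: edges_def edge_comp_def edge_inv_def P.comp_in)
qed

end

section \<open>Homotopy as an equivalence compatible with concatenation\<close>

context weyl_data
begin

lemma defining_suite_gallery:
  assumes "defining_suite S m \<W> \<theta>"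
  shows "edge_path S \<W> (fst \<theta>) (snd \<theta>)" "gallery_ter \<W> (fst \<theta>, snd \<theta>) = fst \<theta>"
proof -
  have "gallery_cycle S \<W> \<theta>"
    using assms defining_suites_cycles unfolding defining_suite_def st_cycle_def by blast
  then show "edge_path S \<W> (fst \<theta>) (snd \<theta>)" "gallery_ter \<W> (fst \<theta>, snd \<theta>) = fst \<theta>"
    by (metis gallery_cycle_def gallery_def gallery_ini_def prod.collapse)+
qed

text \<open>The moves demand a gallery only on their left-hand side. The right-hand side is one with
  the same ends, since inverse pairs and defining suites are closed and a composite, an edge by the
  side condition, keeps the outer ends.\<close>

lemma elementary_homotopy_props:
  assumes "elementary_homotopy S m \<W> \<beta> \<gamma>"
  shows "gallery S \<W> \<beta>" "gallery S \<W> \<gamma>" "fst \<beta> = fst \<gamma>" "gallery_ter \<W> \<beta> = gallery_ter \<W> \<gamma>"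
proof -
  have "gallery S \<W> \<beta> \<and> gallery S \<W> \<gamma> \<and> fst \<beta> = fst \<gamma> \<and> gallery_ter \<W> \<beta> = gallery_ter \<W> \<gamma>"
    using assms
  proof cases
    case (delete_inverse c xs i ys)
    then show ?thesis
      by (auto simp: gallery_def edge_path_append edge_inv_props gallery_ter_append)
  next
    case (compose_edges c xs i j ys)
    then show ?thesis
      by (auto simp: gallery_def edge_path_append edge_comp_props gallery_ter_append)
  next
    case (delete_suite c xs \<theta> ys)
    then have "gallery_ter \<W> (gallery_ter \<W> (c, xs), snd \<theta>) = gallery_ter \<W> (c, xs)"
      using defining_suite_gallery(2)[of \<theta>] by (simp add: gallery_ini_def)
    with delete_suite show ?thesis
      by (auto simp: gallery_def edge_path_append gallery_ter_append)
  qed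
  then show "gallery S \<W> \<beta>" "gallery S \<W> \<gamma>" "fst \<beta> = fst \<gamma>"
    "gallery_ter \<W> \<beta> = gallery_ter \<W> \<gamma>" by auto
qed

lemma elementary_homotopy_context:
  assumes "elementary_homotopy S m \<W> (c, us) (c, vs)"
    and "edge_path S \<W> c0 xs" "gallery_ter \<W> (c0, xs) = c" "edge_path S \<W> (gallery_ter \<W> (c, us)) ys"
  shows "elementary_homotopy S m \<W> (c0, xs @ us @ ys) (c0, xs @ vs @ ys)"
proof -
  have "edge_path S \<W> c us"
    using elementary_homotopy_props(1)[OF assms(1)] by (simp add: gallery_def)
  with assms(2-4) have g: "gallery S \<W> (c0, xs @ us @ ys)"
    by (simp add: gallery_def edge_path_append)
  from assms(1) show ?thesis
  proof cases
    case (delete_inverse as i bs)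
    then show ?thesis
      using elementary_homotopy.delete_inverse[of S \<W> c0 "xs @ as" i "bs @ ys" m] g by simp
  next
    case (compose_edges as i j bs)
    then show ?thesis
      using elementary_homotopy.compose_edges[of S \<W> c0 "xs @ as" i j "bs @ ys" m] g by simp
  next
    case (delete_suite as \<theta> bs)
    then show ?thesis
      using elementary_homotopy.delete_suite[of S \<W> c0 "xs @ as" \<theta> "bs @ ys" m] g assms(3)
      by (simp add: gallery_ter_append)
  qed
qed

lemma homotopic_refl: "gallery S \<W> \<beta> \<Longrightarrow> homotopic S m \<W> \<beta> \<beta>"
  by (simp add: homotopic_def)

lemma homotopic_sym: "homotopic S m \<W> \<beta> \<gamma> \<Longrightarrow> homotopic S m \<W> \<gamma> \<beta>"
  by (simp add: homotopic_def equivclp_sym)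

lemma homotopic_trans:
  "homotopic S m \<W> \<beta> \<gamma> \<Longrightarrow> homotopic S m \<W> \<gamma> \<delta> \<Longrightarrow> homotopic S m \<W> \<beta> \<delta>"
  by (auto simp: homotopic_def intro: equivclp_trans)

lemma elementary_homotopic: "elementary_homotopy S m \<W> \<beta> \<gamma> \<Longrightarrow> homotopic S m \<W> \<beta> \<gamma>"
  by (auto simp: homotopic_def elementary_homotopy_props r_into_equivclp)

text \<open>The induction carries the homotopy from the starting gallery along, so that every stage
  knows the ends of the current gallery. A move and its inverse become separate cases because they
  are lifted along a covering in different ways.\<close>

lemma homotopic_induct [consumes 1, case_names refl forward backward]:
  assumes "homotopic S m \<W> \<beta> \<gamma>"
    and "P \<beta>"
    and "\<And>\<gamma> \<delta>. homotopic S m \<W> \<beta> \<gamma> \<Longrightarrow> P \<gamma> \<Longrightarrow> elementary_homotopy S m \<W> \<gamma> \<delta> \<Longrightarrow> P \<delta>"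
    and "\<And>\<gamma> \<delta>. homotopic S m \<W> \<beta> \<gamma> \<Longrightarrow> P \<gamma> \<Longrightarrow> elementary_homotopy S m \<W> \<delta> \<gamma> \<Longrightarrow> P \<delta>"
  shows "P \<gamma>"
proof -
  have "gallery S \<W> \<beta>" and e: "equivclp (elementary_homotopy S m \<W>) \<beta> \<gamma>"
    using assms(1) by (auto simp: homotopic_def)
  from e have "homotopic S m \<W> \<beta> \<gamma> \<and> P \<gamma>"
  proof (induction rule: equivclp_induct)
    case base
    show ?case using \<open>gallery S \<W> \<beta>\<close> assms(2) by (simp add: homotopic_refl)
  next
    case (step y z)
    then show ?case
      using assms(3,4) by (meson elementary_homotopic homotopic_sym homotopic_trans)
  qed
  then show ?thesis by simp
qed

lemma homotopic_ends:
  assumes "homotopic S m \<W> \<beta> \<gamma>"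
  shows "fst \<beta> = fst \<gamma> \<and> gallery_ter \<W> \<beta> = gallery_ter \<W> \<gamma>"
  using assms by (induction rule: homotopic_induct) (auto simp: elementary_homotopy_props)

lemma homotopic_context:
  assumes "homotopic S m \<W> (c, us) (c, vs)"
    and "edge_path S \<W> c0 xs" "gallery_ter \<W> (c0, xs) = c" "edge_path S \<W> (gallery_ter \<W> (c, us)) ys"
  shows "homotopic S m \<W> (c0, xs @ us @ ys) (c0, xs @ vs @ ys)"
proof -
  have g: "gallery S \<W> (c0, xs @ us @ ys)"
    using assms by (simp add: homotopic_def gallery_def edge_path_append)
  \<comment> \<open>Written with \<open>snd\<close> so that the induction may run through arbitrary
    galleries; \<open>homotopic_ends\<close> recovers that they all start at \<open>c\<close> and
    end where \<open>us\<close> does, which is what the surrounding paths need.\<close>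
  have "homotopic S m \<W> (c0, xs @ snd (c, us) @ ys) (c0, xs @ snd (c, vs) @ ys)"
    using assms(1)
  proof (induction rule: homotopic_induct)
    case refl
    show ?case using g by (simp add: homotopic_refl)
  next
    case (forward \<gamma> \<delta>)
    have "fst \<gamma> = c" "gallery_ter \<W> \<gamma> = gallery_ter \<W> (c, us)"
      using homotopic_ends[OF forward(1)] by auto
    moreover have "fst \<delta> = c"
      using calculation elementary_homotopy_props(3)[OF forward(2)] by simp
    ultimately have "elementary_homotopy S m \<W> (c0, xs @ snd \<gamma> @ ys) (c0, xs @ snd \<delta> @ ys)"
      using elementary_homotopy_context[OF _ assms(2,3), of "snd \<gamma>" "snd \<delta>" ys]
        forward(2) assms(4) by (cases \<gamma>; cases \<delta>) simp
    then show ?case using forward(3) elementary_homotopic homotopic_trans by blast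
  next
    case (backward \<gamma> \<delta>)
    have "fst \<delta> = c" "gallery_ter \<W> \<delta> = gallery_ter \<W> (c, us)"
      using homotopic_ends[OF backward(1)] elementary_homotopy_props(3,4)[OF backward(2)] by auto
    moreover have "fst \<gamma> = c"
      using homotopic_ends[OF backward(1)] by simp
    ultimately have "elementary_homotopy S m \<W> (c0, xs @ snd \<delta> @ ys) (c0, xs @ snd \<gamma> @ ys)"
      using elementary_homotopy_context[OF _ assms(2,3), of "snd \<delta>" "snd \<gamma>" ys]
        backward(2) assms(4) by (cases \<gamma>; cases \<delta>) simp
    then show ?case
      using backward(3) elementary_homotopic homotopic_sym homotopic_trans by blast
  qed
  then show ?thesis by simp
qed

text \<open>\<open>suite\<close> asks for some trivial gallery, but homotopy fixes both ends, which
  forces the one at the initial chamber.\<close>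

lemma suite_homotopic_trivial:
  assumes "suite S m \<W> \<theta>"
  shows "homotopic S m \<W> \<theta> (fst \<theta>, [])" "gallery_ter \<W> \<theta> = fst \<theta>"
proof -
  obtain c where "homotopic S m \<W> \<theta> (c, [])" using assms by (auto simp: suite_def)
  with homotopic_ends[OF this] show "homotopic S m \<W> \<theta> (fst \<theta>, [])"
    "gallery_ter \<W> \<theta> = fst \<theta>" by auto
qed

text \<open>The whole cycle is deleted in one move with empty surroundings. For the quotient map
  this turns images of defining suites, which are defining suites by construction, into the suites
  that a morphism must produce.\<close>

lemma defining_suite_is_suite:
  assumes "defining_suite S m \<W> \<theta>"
  shows "suite S m \<W> \<theta>"
proof -
  have "elementary_homotopy S m \<W> (fst \<theta>, [] @ snd \<theta> @ []) (fst \<theta>, [] @ [])"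
    using assms defining_suite_gallery[OF assms]
    by (intro delete_suite) (auto simp: gallery_def gallery_ini_def)
  from elementary_homotopic[OF this] have "homotopic S m \<W> \<theta> (fst \<theta>, [])" by simp
  moreover have "fst \<theta> \<in> chambers \<W>"
    using edge_path_start defining_suite_gallery[OF assms] by blast
  moreover obtain s t where "st_cycle S m \<W> s t \<theta>"
    using assms defining_suites_cycles unfolding defining_suite_def by blast
  ultimately show ?thesis unfolding suite_def by blast
qed

text \<open>Extends the deletion move from defining suites to suites, the only cycles available
  after mapping or lifting a defining suite.\<close>

lemma suite_deletion_homotopic:
  assumes "gallery S \<W> (c, xs @ snd \<theta> @ ys)" "suite S m \<W> \<theta>" "fst \<theta> = gallery_ter \<W> (c, xs)"
  shows "homotopic S m \<W> (c, xs @ snd \<theta> @ ys) (c, xs @ ys)"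
proof -
  have path: "edge_path S \<W> c xs"
    "edge_path S \<W> (gallery_ter \<W> (gallery_ter \<W> (c, xs), snd \<theta>)) ys"
    using assms(1) by (auto simp: gallery_def edge_path_append)
  have "homotopic S m \<W> (fst \<theta>, snd \<theta>) (fst \<theta>, [])"
    using suite_homotopic_trivial(1)[OF assms(2)] by simp
  from homotopic_context[OF this path(1) assms(3)[symmetric], of ys] show ?thesis
    using path(2) by (simp add: assms(3))
qed

end

section \<open>Morphisms\<close>

lemma fst_map_gallery [simp]: "fst (map_gallery f f' \<beta>) = f (fst \<beta>)"
  and snd_map_gallery [simp]: "snd (map_gallery f f' \<beta>) = map f' (snd \<beta>)"
  by (simp_all add: map_gallery_def)

lemma chamber_system_morphism_edge:
  assumes "chamber_system_morphism S \<V> \<W> f f'" "i \<in> edges S \<V>"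
  shows "f' i \<in> edges S \<W>" "fst (f' i) = fst i"
    "edge_ini \<W> (f' i) = f (edge_ini \<V> i)" "edge_ter \<W> (f' i) = f (edge_ter \<V> i)"
    "f' (edge_inv \<V> i) = edge_inv \<W> (f' i)"
  using assms unfolding chamber_system_morphism_def by blast+

lemma chamber_system_morphism_comp:
  assumes "chamber_system_morphism S \<V> \<W> f f'" "i \<in> edges S \<V>" "j \<in> edges S \<V>"
    and "fst i = fst j" "edge_ter \<V> i = edge_ini \<V> j" "j \<noteq> edge_inv \<V> i"
  shows "f' (edge_comp \<V> i j) = edge_comp \<W> (f' i) (f' j)"
  using assms unfolding chamber_system_morphism_def by blast

lemma edge_path_map:
  assumes "chamber_system_morphism S \<V> \<W> f f'" "edge_path S \<V> c xs"
  shows "edge_path S \<W> (f c) (map f' xs)" "gallery_ter \<W> (f c, map f' xs) = f (gallery_ter \<V> (c, xs))"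
    "map fst (map f' xs) = map fst xs"
proof -
  have "edge_path S \<W> (f c) (map f' xs) \<and> gallery_ter \<W> (f c, map f' xs) = f (gallery_ter \<V> (c, xs))
      \<and> map fst (map f' xs) = map fst xs"
    using assms(2)
  proof (induction xs arbitrary: c)
    case Nil
    then show ?case using assms(1) by (auto simp: chamber_system_morphism_def)
  next
    case (Cons i xs)
    then show ?case using chamber_system_morphism_edge[OF assms(1), of i] by auto
  qed
  then show "edge_path S \<W> (f c) (map f' xs)"
    "gallery_ter \<W> (f c, map f' xs) = f (gallery_ter \<V> (c, xs))"
    "map fst (map f' xs) = map fst xs" by auto
qed

lemma gallery_map:
  assumes "chamber_system_morphism S \<V> \<W> f f'" "gallery S \<V> \<beta>"
  shows "gallery S \<W> (map_gallery f f' \<beta>)"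
    "gallery_ter \<W> (map_gallery f f' \<beta>) = f (gallery_ter \<V> \<beta>)"
    "gallery_type (map_gallery f f' \<beta>) = gallery_type \<beta>"
  using edge_path_map[OF assms(1), of "fst \<beta>" "snd \<beta>"] assms(2)
  by (auto simp: gallery_def gallery_type_def map_gallery_def)

lemma st_cycle_map:
  assumes "chamber_system_morphism S \<V> \<W> f f'" "st_cycle S m \<V> s t \<beta>"
  shows "st_cycle S m \<W> s t (map_gallery f f' \<beta>)"
  using assms(2) gallery_map[OF assms(1), of \<beta>]
  by (auto simp: st_cycle_def gallery_cycle_def gallery_ini_def)

text \<open>The conclusion is \<open>homotopic\<close> rather than a single move because the image
  of a defining suite is only a suite, whose deletion may take many moves.\<close>

lemma elementary_homotopy_map:
  assumes "weyl_morphism S m \<V> \<W> f f'" "elementary_homotopy S m \<V> \<beta> \<gamma>"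
  shows "homotopic S m \<W> (map_gallery f f' \<beta>) (map_gallery f f' \<gamma>)"
proof -
  interpret V: weyl_data S m \<V> using assms(1) by (simp add: weyl_morphism_def)
  interpret W: weyl_data S m \<W> using assms(1) by (simp add: weyl_morphism_def)
  have f: "chamber_system_morphism S \<V> \<W> f f'" using assms(1) by (simp add: weyl_morphism_def)
  have g: "gallery S \<W> (map_gallery f f' \<beta>)"
    using V.elementary_homotopy_props(1)[OF assms(2)] gallery_map(1)[OF f] by blast
  from assms(2) show ?thesis
  proof cases
    case (delete_inverse c xs i ys)
    then have "i \<in> edges S \<V>" by (auto simp: gallery_def V.edge_path_append)
    then have "f' (edge_inv \<V> i) = edge_inv \<W> (f' i)" by (rule chamber_system_morphism_edge[OF f])
    with delete_inverse g show ?thesis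
      using W.elementary_homotopic[OF elementary_homotopy.delete_inverse[of S \<W> "f c" "map f' xs" "f' i" "map f' ys" m]]
      by (simp add: map_gallery_def)
  next
    case (compose_edges c xs i j ys)
    then have ij: "i \<in> edges S \<V>" "j \<in> edges S \<V>" "edge_ter \<V> i = edge_ini \<V> j"
      by (auto simp: gallery_def V.edge_path_append)
    note k = chamber_system_morphism_comp[OF f ij(1,2) compose_edges(4) ij(3) compose_edges(5)]
    have fst_eq: "fst (f' i) = fst (f' j)"
      using ij compose_edges chamber_system_morphism_edge(2)[OF f] by auto
    \<comment> \<open>A morphism maps the edge \<open>i;j\<close> to an edge, which rules out \<open>f' j = (f' i)\<^sup>-\<^sup>1\<close>.\<close>
    have "edge_comp \<V> i j \<in> edges S \<V>"
      using V.edge_comp_props(3)[of i j] ij compose_edges by auto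
    then have "edge_comp \<W> (f' i) (f' j) \<in> edges S \<W>"
      using chamber_system_morphism_edge(1)[OF f] k by metis
    then have "f' j \<noteq> edge_inv \<W> (f' i)"
      using W.edge_comp_props(3)[of "f' i" "f' j"] ij fst_eq chamber_system_morphism_edge[OF f] by auto
    with compose_edges g k fst_eq show ?thesis
      using W.elementary_homotopic[OF elementary_homotopy.compose_edges[of S \<W> "f c" "map f' xs" "f' i" "f' j" "map f' ys" m]]
      by (simp add: map_gallery_def)
  next
    case (delete_suite c xs \<theta> ys)
    have "suite S m \<W> (map_gallery f f' \<theta>)"
      using assms(1) delete_suite unfolding weyl_morphism_def by blast
    moreover have "f (gallery_ter \<V> (c, xs)) = gallery_ter \<W> (f c, map f' xs)"
      using edge_path_map(2)[OF f, of c xs] delete_suite by (simp add: gallery_def V.edge_path_append)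
    ultimately show ?thesis
      using W.suite_deletion_homotopic[of "f c" "map f' xs" "map_gallery f f' \<theta>" "map f' ys"]
        delete_suite g by (simp add: map_gallery_def gallery_ini_def)
  qed
qed

lemma homotopic_map:
  assumes "weyl_morphism S m \<V> \<W> f f'" "homotopic S m \<V> \<beta> \<gamma>"
  shows "homotopic S m \<W> (map_gallery f f' \<beta>) (map_gallery f f' \<gamma>)"
proof -
  interpret V: weyl_data S m \<V> using assms(1) by (simp add: weyl_morphism_def)
  interpret W: weyl_data S m \<W> using assms(1) by (simp add: weyl_morphism_def)
  from assms(2) show ?thesis
  proof (induction rule: V.homotopic_induct)
    case refl
    then show ?case
      using assms gallery_map(1) W.homotopic_refl unfolding weyl_morphism_def homotopic_def by blast
  next
    case (forward \<gamma> \<delta>)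
    then show ?case using elementary_homotopy_map[OF assms(1)] W.homotopic_trans by blast
  next
    case (backward \<gamma> \<delta>)
    then show ?case
      using elementary_homotopy_map[OF assms(1)] W.homotopic_trans W.homotopic_sym by blast
  qed
qed

section \<open>Coverings\<close>

lemma etale_edge_inj:
  assumes "surjective_etale S \<V> \<W> p p'" "c \<in> chambers \<V>"
    and "i \<in> edges S \<V>" "j \<in> edges S \<V>" "edge_ini \<V> i = c" "edge_ini \<V> j = c" "p' i = p' j"
  shows "i = j"
  using assms unfolding surjective_etale_def bij_betw_def inj_on_def edges_from_def by blast

lemma etale_edge_lift:
  assumes "surjective_etale S \<V> \<W> p p'" "c \<in> chambers \<V>" "k \<in> edges S \<W>" "edge_ini \<W> k = p c"
  obtains i where "i \<in> edges S \<V>" "edge_ini \<V> i = c" "p' i = k"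
proof -
  have "k \<in> p' ` edges_from S \<V> c"
    using assms by (auto simp: surjective_etale_def bij_betw_def edges_from_def)
  then show ?thesis using that by (auto simp: edges_from_def)
qed

text \<open>Injectivity on the edges leaving a chamber determines the first edge, hence the chamber
  where the rest of the path starts, and the argument repeats from there.\<close>

lemma edge_path_lift_unique:
  assumes "generalized_chamber_system S m \<V>" "surjective_etale S \<V> \<W> p p'"
    and "edge_path S \<V> c xs" "edge_path S \<V> c ys" "map p' xs = map p' ys"
  shows "xs = ys"
proof -
  interpret V: generalized_chamber_system S m \<V> by fact
  show ?thesis using assms(3-5)
  proof (induction xs arbitrary: c ys)
    case (Cons i xs)
    then obtain j zs where ys: "ys = j # zs" "p' i = p' j" "map p' xs = map p' zs" by auto
    moreover have "c \<in> chambers \<V>" using V.edge_path_start Cons.prems(1) .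
    ultimately have "i = j"
      using Cons.prems etale_edge_inj[OF assms(2), of c i j] by simp
    then show ?case using Cons ys by auto
  qed simp
qed

lemma gallery_lift_unique:
  assumes "generalized_chamber_system S m \<V>" "surjective_etale S \<V> \<W> p p'"
    and "gallery S \<V> \<beta>" "gallery S \<V> \<gamma>" "fst \<beta> = fst \<gamma>"
    and "map_gallery p p' \<beta> = map_gallery p p' \<gamma>"
  shows "\<beta> = \<gamma>"
  using edge_path_lift_unique[OF assms(1,2), of "fst \<beta>" "snd \<beta>" "snd \<gamma>"] assms(3-6)
  by (auto simp: gallery_def map_gallery_def prod_eq_iff)

lemma edge_path_lift:
  assumes "generalized_chamber_system S m \<V>" "surjective_etale S \<V> \<W> p p'" "c \<in> chambers \<V>"
    and "edge_path S \<W> (p c) ks"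
  obtains xs where "edge_path S \<V> c xs" "map p' xs = ks"
proof -
  interpret V: generalized_chamber_system S m \<V> by fact
  have p: "chamber_system_morphism S \<V> \<W> p p'" using assms(2) by (simp add: surjective_etale_def)
  have "\<exists>xs. edge_path S \<V> c xs \<and> map p' xs = ks"
    using assms(3,4)
  proof (induction ks arbitrary: c)
    case (Cons k ks)
    from Cons.prems have "k \<in> edges S \<W>" "edge_ini \<W> k = p c" by auto
    then obtain i where i: "i \<in> edges S \<V>" "edge_ini \<V> i = c" "p' i = k"
      using etale_edge_lift[OF assms(2) Cons.prems(1)] by metis
    then have "edge_path S \<W> (p (edge_ter \<V> i)) ks"
      using Cons.prems chamber_system_morphism_edge(4)[OF p, of i] by auto
    with Cons.IH V.edge_ter_in i(1) obtain xs where "edge_path S \<V> (edge_ter \<V> i) xs" "map p' xs = ks"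
      by blast
    with i show ?case by (intro exI[of _ "i # xs"]) auto
  qed auto
  then show ?thesis using that by blast
qed

lemma gallery_lift:
  assumes "generalized_chamber_system S m \<V>" "surjective_etale S \<V> \<W> p p'" "gallery S \<W> \<beta>"
    and "c \<in> chambers \<V>" "p c = fst \<beta>"
  obtains \<beta>' where "gallery S \<V> \<beta>'" "map_gallery p p' \<beta>' = \<beta>" "fst \<beta>' = c"
proof -
  obtain xs where "edge_path S \<V> c xs" "map p' xs = snd \<beta>"
    using edge_path_lift[OF assms(1,2,4), of "snd \<beta>"] assms(3,5) by (auto simp: gallery_def)
  then show ?thesis
    using that[of "(c, xs)"] assms(5) by (simp add: gallery_def map_gallery_def prod_eq_iff)
qed

text \<open>Treats only moves in their deleting or merging direction: the edges concerned are
  already present in \<beta>, so it suffices to recognise their preimages as an inverse pair, a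
  composable pair or a suite.\<close>

lemma elementary_homotopy_lift:
  assumes p: "weyl_covering S m \<V> \<W> p p'" and g: "gallery S \<V> \<beta>"
    and h: "elementary_homotopy S m \<W> (map_gallery p p' \<beta>) \<gamma>"
  shows "\<exists>\<gamma>'. homotopic S m \<V> \<beta> \<gamma>' \<and> map_gallery p p' \<gamma>' = \<gamma>"
proof -
  interpret V: weyl_data S m \<V> using p by (simp add: weyl_covering_def weyl_morphism_def)
  interpret W: weyl_data S m \<W> using p by (simp add: weyl_covering_def weyl_morphism_def)
  have etale: "surjective_etale S \<V> \<W> p p'" using p by (simp add: weyl_covering_def)
  then have f: "chamber_system_morphism S \<V> \<W> p p'" by (simp add: surjective_etale_def)
  obtain d zs where \<beta>: "\<beta> = (d, zs)" by (cases \<beta>)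
  from h show ?thesis
  proof cases
    case (delete_inverse c ks k ls)
    then obtain xs i j ys where zs: "zs = xs @ [i, j] @ ys" "map p' xs = ks" "p' i = k"
        "p' j = edge_inv \<W> k" "map p' ys = ls"
      by (auto simp: \<beta> map_gallery_def map_eq_append_conv map_eq_Cons_conv)
    have ij: "i \<in> edges S \<V>" "j \<in> edges S \<V>" "edge_ini \<V> j = edge_ter \<V> i"
      using g zs by (auto simp: \<beta> gallery_def V.edge_path_append)
    have "j = edge_inv \<V> i"
      using etale_edge_inj[OF etale _ ij(2), of "edge_ter \<V> i" "edge_inv \<V> i"] ij zs
        V.edge_inv_props V.edge_ter_in chamber_system_morphism_edge(5)[OF f] by auto
    then have "homotopic S m \<V> \<beta> (d, xs @ ys)"
      using V.elementary_homotopic[OF elementary_homotopy.delete_inverse] g \<beta> zs by metis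
    then show ?thesis
      using delete_inverse zs \<beta> by (intro exI[of _ "(d, xs @ ys)"]) (auto simp: map_gallery_def)
  next
    case (compose_edges c ks k l ls)
    then obtain xs i j ys where zs: "zs = xs @ [i, j] @ ys" "map p' xs = ks" "p' i = k"
        "p' j = l" "map p' ys = ls"
      by (auto simp: \<beta> map_gallery_def map_eq_append_conv map_eq_Cons_conv)
    have ij: "i \<in> edges S \<V>" "j \<in> edges S \<V>" "edge_ter \<V> i = edge_ini \<V> j"
      using g zs by (auto simp: \<beta> gallery_def V.edge_path_append)
    have ne: "j \<noteq> edge_inv \<V> i"
      using compose_edges(5) zs(3,4) chamber_system_morphism_edge(5)[OF f ij(1)] by metis
    have eq: "fst i = fst j"
      using compose_edges(4) zs(3,4) ij chamber_system_morphism_edge(2)[OF f] by metis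
    have "homotopic S m \<V> \<beta> (d, xs @ [edge_comp \<V> i j] @ ys)"
      using V.elementary_homotopic[OF elementary_homotopy.compose_edges[OF _ eq ne]] g \<beta> zs by metis
    then show ?thesis
      using compose_edges zs \<beta> chamber_system_morphism_comp[OF f ij(1,2) eq ij(3) ne]
      by (intro exI[of _ "(d, xs @ [edge_comp \<V> i j] @ ys)"]) (auto simp: map_gallery_def)
  next
    case (delete_suite c ks \<theta> ls)
    then have "map p' zs = ks @ snd \<theta> @ ls" by (simp add: \<beta> map_gallery_def)
    then obtain xs vs where "zs = xs @ vs" "map p' xs = ks" "map p' vs = snd \<theta> @ ls"
      by (auto simp: map_eq_append_conv[of p' zs])
    moreover from this(3) obtain us ys where "vs = us @ ys" "map p' us = snd \<theta>" "map p' ys = ls"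
      by (auto simp: map_eq_append_conv[of p' vs])
    ultimately have zs: "zs = xs @ us @ ys" "map p' xs = ks" "map p' us = snd \<theta>" "map p' ys = ls"
      by simp_all
    have path: "edge_path S \<V> d xs" "edge_path S \<V> (gallery_ter \<V> (d, xs)) us"
      using g zs by (auto simp: \<beta> gallery_def V.edge_path_append)
    \<comment> \<open>The stretch of \<beta> over \<theta>, based at the chamber where it really
      starts. Nothing so far says that it is closed; the covering condition supplies this by
      declaring it a suite.\<close>
    let ?\<theta> = "(gallery_ter \<V> (d, xs), us)"
    have "map_gallery p p' ?\<theta> = \<theta>"
      using delete_suite zs edge_path_map(2)[OF f path(1)]
      by (simp add: map_gallery_def prod_eq_iff gallery_ini_def \<beta>)
    then have "suite S m \<V> ?\<theta>"
      using p path(2) delete_suite unfolding weyl_covering_def gallery_def by auto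
    then have "homotopic S m \<V> \<beta> (d, xs @ ys)"
      using V.suite_deletion_homotopic[of d xs ?\<theta> ys] g zs by (simp add: \<beta>)
    then show ?thesis
      using delete_suite zs \<beta> by (intro exI[of _ "(d, xs @ ys)"]) (auto simp: map_gallery_def)
  qed
qed

lemma homotopic_lift:
  assumes p: "weyl_covering S m \<V> \<W> p p'" and g: "gallery S \<V> \<beta>"
    and h: "homotopic S m \<W> (map_gallery p p' \<beta>) \<gamma>"
  shows "\<exists>\<gamma>'. homotopic S m \<V> \<beta> \<gamma>' \<and> map_gallery p p' \<gamma>' = \<gamma>"
proof -
  interpret V: weyl_data S m \<V> using p by (simp add: weyl_covering_def weyl_morphism_def)
  interpret W: weyl_data S m \<W> using p by (simp add: weyl_covering_def weyl_morphism_def)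
  have V: "generalized_chamber_system S m \<V>" by unfold_locales
  have etale: "surjective_etale S \<V> \<W> p p'" using p by (simp add: weyl_covering_def)
  from h show ?thesis
  proof (induction rule: W.homotopic_induct)
    case refl
    then show ?case using V.homotopic_refl g by blast
  next
    case (forward \<gamma> \<delta>)
    then obtain \<gamma>' where \<gamma>': "homotopic S m \<V> \<beta> \<gamma>'" "map_gallery p p' \<gamma>' = \<gamma>" by blast
    then have "gallery S \<V> \<gamma>'" by (simp add: homotopic_def)
    then show ?case
      using elementary_homotopy_lift[OF p] forward.hyps \<gamma>' V.homotopic_trans by metis
  next
    case (backward \<gamma> \<delta>)
    then obtain \<gamma>' where \<gamma>': "homotopic S m \<V> \<beta> \<gamma>'" "map_gallery p p' \<gamma>' = \<gamma>" by blast
    then have g': "gallery S \<V> \<gamma>'" by (simp add: homotopic_def)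
    \<comment> \<open>An inverse move inserts edges that would have to be found upstairs. Instead
      \<delta>, the gallery before the move, is lifted from the initial chamber of \<gamma>' and the
      move is run forwards on this lift. Its outcome \<epsilon> lies over \<gamma> and starts where
      \<gamma>' does, so the two coincide.\<close>
    have c: "fst \<gamma>' \<in> chambers \<V>" using g' V.edge_path_start by (auto simp: gallery_def)
    have "p (fst \<gamma>') = fst \<delta>"
      using W.elementary_homotopy_props(3)[OF backward(2)] \<gamma>'(2) by auto
    then obtain \<delta>' where \<delta>': "gallery S \<V> \<delta>'" "map_gallery p p' \<delta>' = \<delta>" "fst \<delta>' = fst \<gamma>'"
      using gallery_lift[OF V etale W.elementary_homotopy_props(1)[OF backward(2)] c] by blast
    obtain \<epsilon> where \<epsilon>: "homotopic S m \<V> \<delta>' \<epsilon>" "map_gallery p p' \<epsilon> = \<gamma>"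
      using elementary_homotopy_lift[OF p \<delta>'(1)] backward(2) \<delta>'(2) by metis
    have "gallery S \<V> \<epsilon>" using \<epsilon>(1) by (simp add: homotopic_def)
    moreover have "fst \<epsilon> = fst \<gamma>'"
      using V.homotopic_ends[OF \<epsilon>(1)] \<delta>'(3) by simp
    ultimately have "\<epsilon> = \<gamma>'" using gallery_lift_unique[OF V etale _ g'] \<epsilon>(2) \<gamma>'(2) by simp
    then show ?case using \<epsilon>(1) \<gamma>'(1) \<delta>'(2) V.homotopic_sym V.homotopic_trans by blast
  qed
qed

section \<open>Descent of the axioms from a covering to its base\<close>

lemma (in generalized_chamber_system) panel_trivial_iff:
  assumes "s \<in> S" "c \<in> chambers \<W>"
  shows "trivial_groupoid (groupoid_component (panel_groupoid \<W> s) c) \<longleftrightarrow>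
    \<not> (\<exists>i \<in> edges S \<W>. fst i = s \<and> edge_ini \<W> i = c)"
proof -
  interpret P: groupoid "panel_groupoid \<W> s" using panel_groupoid assms(1) .
  let ?\<Gamma> = "panel_groupoid \<W> s"
  let ?V = "{u. \<exists>g \<in> Arr ?\<Gamma>. ini ?\<Gamma> g = c \<and> ter ?\<Gamma> g = u}"
  have V: "Vert ?\<Gamma> = chambers \<W>" using panel_vertices assms(1) .
  have id: "gid ?\<Gamma> c \<in> Arr ?\<Gamma>" "ini ?\<Gamma> (gid ?\<Gamma> c) = c" "ter ?\<Gamma> (gid ?\<Gamma> c) = c"
    using assms(2) V by (auto simp: P.id_in P.ini_id P.ter_id)
  then have cV: "c \<in> ?V" by blast
  have "trivial_groupoid (groupoid_component ?\<Gamma> c) \<longleftrightarrow> card ?V = 1 \<and> card {g \<in> Arr ?\<Gamma>. ini ?\<Gamma> g \<in> ?V} = 1"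
    by (simp add: trivial_groupoid_def groupoid_component_def Let_def)
  \<comment> \<open>If the component has a single arrow, every arrow leaving \<open>c\<close> is the
    identity at \<open>c\<close>. Conversely, if only that identity leaves \<open>c\<close>, no
    other vertex is reached, so the arrows of the component are those leaving
    \<open>c\<close>.\<close>
  also have "\<dots> \<longleftrightarrow> (\<forall>g \<in> Arr ?\<Gamma>. ini ?\<Gamma> g = c \<longrightarrow> g = gid ?\<Gamma> c)" (is "?L \<longleftrightarrow> ?R")
  proof
    assume ?L
    then obtain a where "{g \<in> Arr ?\<Gamma>. ini ?\<Gamma> g \<in> ?V} = {a}" by (auto simp: card_1_singleton_iff)
    then have "g = a" if "g \<in> Arr ?\<Gamma>" "ini ?\<Gamma> g = c" for g using that cV by blast
    then show ?R using id by metis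
  next
    assume R: ?R
    have "?V \<subseteq> {c}"
    proof
      fix u assume "u \<in> ?V"
      then obtain g where "g \<in> Arr ?\<Gamma>" "ini ?\<Gamma> g = c" "ter ?\<Gamma> g = u" by blast
      with R id(3) show "u \<in> {c}" by simp
    qed
    then have V_eq: "?V = {c}" using cV by blast
    moreover have "{g \<in> Arr ?\<Gamma>. ini ?\<Gamma> g \<in> ?V} = {gid ?\<Gamma> c}"
      unfolding V_eq using R id by blast
    ultimately show ?L by simp
  qed
  also have "\<dots> \<longleftrightarrow> \<not> (\<exists>i \<in> edges S \<W>. fst i = s \<and> edge_ini \<W> i = c)"
    using assms V id by (force simp: edges_def edge_ini_def P.ini_id)
  finally show ?thesis .
qed

lemma two_weyl_graph_covered:
  assumes p: "weyl_covering S m \<V> \<W> p p'" and "two_weyl_graph S m \<V>"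
  shows "two_weyl_graph S m \<W>"
proof -
  interpret V: two_weyl_graph S m \<V> by fact
  interpret W: weyl_data S m \<W> using p by (simp add: weyl_covering_def weyl_morphism_def)
  have V: "generalized_chamber_system S m \<V>" by unfold_locales
  have mor: "weyl_morphism S m \<V> \<W> p p'" using p by (simp add: weyl_covering_def)
  have etale: "surjective_etale S \<V> \<W> p p'" using p by (simp add: weyl_covering_def)
  then have f: "chamber_system_morphism S \<V> \<W> p p'" by (simp add: surjective_etale_def)
  \<comment> \<open>Surjectivity on chambers supplies a starting point. Keeping the type is
    decisive: maximality, being reduced or alternating, and the \<open>W_length\<close> are all read
    off the type, so they agree for a gallery and its lift.\<close>
  have lift: "\<exists>\<beta>'. gallery S \<V> \<beta>' \<and> map_gallery p p' \<beta>' = \<beta> \<and> gallery_type \<beta>' = gallery_type \<beta>"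
    if \<beta>: "gallery S \<W> \<beta>" for \<beta>
  proof -
    have "fst \<beta> \<in> chambers \<W>" using \<beta> W.edge_path_start by (auto simp: gallery_def)
    then obtain c where "c \<in> chambers \<V>" "p c = fst \<beta>"
      using etale unfolding surjective_etale_def by (metis imageE)
    then obtain \<beta>' where "gallery S \<V> \<beta>'" "map_gallery p p' \<beta>' = \<beta>"
      using gallery_lift[OF V etale \<beta>] by blast
    then show ?thesis using gallery_map(3)[OF f] by metis
  qed
  show ?thesis
  proof
    fix s P assume s: "s \<in> S" and "P \<in> panels \<W> s"
    then obtain c where c: "c \<in> chambers \<V>" "P = groupoid_component (panel_groupoid \<W> s) (p c)"
      using etale unfolding panels_def surjective_etale_def by (metis imageE)
    have pc: "p c \<in> chambers \<W>" using f c by (simp add: chamber_system_morphism_def)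
    have "\<not> trivial_groupoid (groupoid_component (panel_groupoid \<V> s) c)"
      using V.PW0 s c by (simp add: panels_def)
    \<comment> \<open>\<open>panel_trivial_iff\<close> rephrases (PW0) as the existence of an edge
      of type \<open>s\<close> issuing from each chamber, and the image of such an edge is one
      downstairs.\<close>
    then obtain i where "i \<in> edges S \<V>" "fst i = s" "edge_ini \<V> i = c"
      using V.panel_trivial_iff[OF s c(1)] by auto
    then show "\<not> trivial_groupoid P"
      using W.panel_trivial_iff[OF s pc] c(2) chamber_system_morphism_edge[OF f] by metis
  next
    fix s t \<beta> assume \<beta>: "maximal_st_geodesic S m \<W> s t \<beta>"
    then obtain \<beta>' where \<beta>': "gallery S \<V> \<beta>'" "map_gallery p p' \<beta>' = \<beta>" "gallery_type \<beta>' = gallery_type \<beta>"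
      using lift unfolding maximal_st_geodesic_def by blast
    with \<beta> have "maximal_st_geodesic S m \<V> s t \<beta>'" by (simp add: maximal_st_geodesic_def)
    then obtain \<gamma>' where "maximal_st_geodesic S m \<V> t s \<gamma>'" "homotopic S m \<V> \<beta>' \<gamma>'"
      using V.PW1 by blast
    then show "\<exists>\<gamma>. maximal_st_geodesic S m \<W> t s \<gamma> \<and> homotopic S m \<W> \<beta> \<gamma>"
      using homotopic_map[OF mor, of \<beta>' \<gamma>'] gallery_map[OF f, of \<gamma>'] \<beta>'(2)
      by (intro exI[of _ "map_gallery p p' \<gamma>'"]) (auto simp: maximal_st_geodesic_def)
  next
    fix \<beta> \<gamma>
    assume alt: "alternating_geodesic S m \<W> \<beta>" "alternating_geodesic S m \<W> \<gamma>"
      and h: "homotopic S m \<W> \<beta> \<gamma>"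
    obtain \<beta>' where \<beta>': "gallery S \<V> \<beta>'" "map_gallery p p' \<beta>' = \<beta>"
      using lift h unfolding homotopic_def by blast
    \<comment> \<open>The lift of \<gamma> is taken as the end of the lifted homotopy; a lift chosen
      independently might start at another chamber of the fibre.\<close>
    then obtain \<gamma>' where \<gamma>': "homotopic S m \<V> \<beta>' \<gamma>'" "map_gallery p p' \<gamma>' = \<gamma>"
      using homotopic_lift[OF p] h by metis
    have alt_lift: "alternating_geodesic S m \<V> \<delta>"
      if "gallery S \<V> \<delta>" "alternating_geodesic S m \<W> (map_gallery p p' \<delta>)" for \<delta>
      using that gallery_map(3)[OF f that(1)]
      by (auto simp: alternating_geodesic_def st_geodesic_def geodesic_def)
    have "gallery S \<V> \<gamma>'" using \<gamma>' by (simp add: homotopic_def)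
    then show "W_length S m \<beta> = W_length S m \<gamma>"
      using V.two_weyl[OF alt_lift alt_lift \<gamma>'(1)] alt \<beta>' \<gamma>'(2)
        gallery_map(3)[OF f, of \<beta>'] gallery_map(3)[OF f, of \<gamma>'] by (simp add: W_length_def)
  qed
qed

section \<open>Quotients by chamber-free actions\<close>

context weyl_action
begin

lemma panel_action_one:
  assumes "s \<in> S" "e \<in> Arr (panel_groupoid \<W> s)"
  shows "panel_action \<W> \<phi> \<psi> s \<one> e = e"
proof (cases "e \<in> gid (panel_groupoid \<W> s) ` Vert (panel_groupoid \<W> s)")
  case True
  then obtain c where c: "c \<in> chambers \<W>" "e = gid (panel_groupoid \<W> s) c"
    using panel_vertices assms(1) by auto
  have "\<one> \<in> carrier G"
    using chamber_action.group_hom group_hom.axioms(1) group.is_monoid monoid.one_closed by blast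
  with c assms show ?thesis by (simp add: panel_action_id chamber_action.id_eq_one[symmetric])
next
  case False
  then have "(s, e) \<in> edges S \<W>" using assms by (simp add: edges_def)
  moreover from this have "\<psi> \<one> (s, e) = (s, e)"
    using edge_action.id_eq_one by (metis restrict_apply')
  ultimately show ?thesis using False by (simp add: panel_action_def Let_def)
qed

lemma panel_action_mult:
  assumes "s \<in> S" "e \<in> Arr (panel_groupoid \<W> s)" "g \<in> carrier G" "h \<in> carrier G"
  shows "panel_action \<W> \<phi> \<psi> s (g \<otimes> h) e = panel_action \<W> \<phi> \<psi> s g (panel_action \<W> \<phi> \<psi> s h e)"
proof -
  have gh: "g \<otimes> h \<in> carrier G"
    using assms chamber_action.group_hom group_hom.axioms(1) group.is_monoid monoid.m_closed by metis
  show ?thesis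
  proof (cases "e \<in> gid (panel_groupoid \<W> s) ` Vert (panel_groupoid \<W> s)")
    case True
    then obtain c where c: "c \<in> chambers \<W>" "e = gid (panel_groupoid \<W> s) c"
      using panel_vertices assms(1) by auto
    then show ?thesis
      using assms gh chamber_in by (simp add: panel_action_id chamber_action.composition_rule)
  next
    case False
    then have i: "(s, e) \<in> edges S \<W>" using assms by (simp add: edges_def)
    \<comment> \<open>A translate of a non-identity arrow is again an edge, so the second
      application of \<open>panel_action\<close> is also governed by \<psi>.\<close>
    have j: "(s, panel_action \<W> \<phi> \<psi> s h e) \<in> edges S \<W>"
      using panel_action_nonid[OF i assms(4)] edge_action_props(1)[OF assms(4) i] by simp
    have "(s, panel_action \<W> \<phi> \<psi> s (g \<otimes> h) e) = (s, panel_action \<W> \<phi> \<psi> s g (panel_action \<W> \<phi> \<psi> s h e))"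
      using i j assms gh by (simp add: panel_action_nonid edge_action.composition_rule)
    then show ?thesis by simp
  qed
qed

lemma orbit_panel_action_eq_iff:
  assumes "s \<in> S" "e \<in> Arr (panel_groupoid \<W> s)" "h \<in> Arr (panel_groupoid \<W> s)"
  shows "orbit G (panel_action \<W> \<phi> \<psi> s) e = orbit G (panel_action \<W> \<phi> \<psi> s) h
    \<longleftrightarrow> (\<exists>g \<in> carrier G. h = panel_action \<W> \<phi> \<psi> s g e)"
proof -
  interpret group G using chamber_action.group_hom group_hom.axioms(1) by blast
  let ?a = "panel_action \<W> \<phi> \<psi> s"
  have self: "x \<in> orbit G ?a x" if "x \<in> Arr (panel_groupoid \<W> s)" for x
    unfolding orbit_def using that panel_action_one[OF assms(1) that] by (metis (mono_tags, lifting) mem_Collect_eq one_closed)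
  \<comment> \<open>One inclusion is enough: it is applied to \<open>g\<close>, and then to the
    inverse of \<open>g\<close>, which carries \<open>h\<close> back to \<open>e\<close>.\<close>
  have sub: "orbit G ?a (?a g x) \<subseteq> orbit G ?a x"
    if "x \<in> Arr (panel_groupoid \<W> s)" "g \<in> carrier G" for x g
    using that panel_action_mult[OF assms(1)] unfolding orbit_image
    by (auto simp: panel_action_mult[OF assms(1), symmetric])
  show ?thesis
  proof
    assume "orbit G ?a e = orbit G ?a h"
    then show "\<exists>g \<in> carrier G. h = ?a g e" using self[OF assms(3)] by (auto simp: orbit_def)
  next
    assume "\<exists>g \<in> carrier G. h = ?a g e"
    then obtain g where g: "g \<in> carrier G" "h = ?a g e" by blast
    then have "?a (inv g) h = e"
      using assms panel_action_mult[OF assms(1,2), of "inv g" g] panel_action_one by simp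
    then show "orbit G ?a e = orbit G ?a h"
      using sub[OF assms(2) g(1)] sub[OF assms(3), of "inv g"] g by auto
  qed
qed

lemma orbit_chamber_eq_iff:
  assumes "c \<in> chambers \<W>" "d \<in> chambers \<W>"
  shows "orbit G \<phi> c = orbit G \<phi> d \<longleftrightarrow> (\<exists>g \<in> carrier G. d = \<phi> g c)"
proof -
  interpret group G using chamber_action.group_hom group_hom.axioms(1) by blast
  have self: "x \<in> orbit G \<phi> x" if "x \<in> chambers \<W>" for x
    using chamber_action.orbit_refl that by blast
  have sub: "orbit G \<phi> (\<phi> g x) \<subseteq> orbit G \<phi> x" if "x \<in> chambers \<W>" "g \<in> carrier G" for x g
    using that unfolding orbit_image by (auto simp: chamber_action.composition_rule[symmetric])
  show ?thesis
  proof
    assume "orbit G \<phi> c = orbit G \<phi> d"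
    then show "\<exists>g \<in> carrier G. d = \<phi> g c" using self[OF assms(2)] by (auto simp: orbit_def)
  next
    assume "\<exists>g \<in> carrier G. d = \<phi> g c"
    then obtain g where g: "g \<in> carrier G" "d = \<phi> g c" by blast
    then have "\<phi> (inv g) d = c" using assms chamber_action.orbit_sym_aux by blast
    then show "orbit G \<phi> c = orbit G \<phi> d"
      using sub[OF assms(1) g(1)] sub[OF assms(2), of "inv g"] g by auto
  qed
qed

section \<open>The quotient panel groupoids\<close>

lemma chambers_quotient: "chambers (weyl_quotient G \<W> \<phi> \<psi>) = orbit G \<phi> ` chambers \<W>"
  by (auto simp: weyl_quotient_def orbits_def)

lemma Vert_quotient:
  "s \<in> S \<Longrightarrow> Vert (panel_groupoid (weyl_quotient G \<W> \<phi> \<psi>) s) = orbit G \<phi> ` chambers \<W>"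
  by (auto simp: weyl_quotient_def quotient_groupoid_def orbits_def panel_vertices)

lemma Arr_quotient:
  "Arr (panel_groupoid (weyl_quotient G \<W> \<phi> \<psi>) s)
    = orbit G (panel_action \<W> \<phi> \<psi> s) ` Arr (panel_groupoid \<W> s)"
  by (auto simp: weyl_quotient_def quotient_groupoid_def orbits_def)

text \<open>Any representative can be translated so that its initial chamber becomes the prescribed
  one in the same orbit. This gives both the lifting of edges and, in the groupoid laws, composable
  representatives of composable orbits.\<close>

lemma quotient_arrow_representative:
  assumes s: "s \<in> S" and c: "c \<in> chambers \<W>"
    and A: "A \<in> Arr (panel_groupoid (weyl_quotient G \<W> \<phi> \<psi>) s)"
    and "ini (panel_groupoid (weyl_quotient G \<W> \<phi> \<psi>) s) A = orbit G \<phi> c"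
  obtains e where "e \<in> Arr (panel_groupoid \<W> s)" "A = orbit G (panel_action \<W> \<phi> \<psi> s) e"
    "ini (panel_groupoid \<W> s) e = c"
proof -
  obtain h where h: "h \<in> Arr (panel_groupoid \<W> s)" "A = orbit G (panel_action \<W> \<phi> \<psi> s) h"
    using A by (auto simp: Arr_quotient)
  have ih: "ini (panel_groupoid \<W> s) h \<in> chambers \<W>"
    using groupoid.ini_in[OF panel_groupoid] panel_vertices s h by blast
  have "orbit G \<phi> (ini (panel_groupoid \<W> s) h) = orbit G \<phi> c"
    using assms(4) h quotient_ini[OF s h(1)] by simp
  then obtain g where g: "g \<in> carrier G" "c = \<phi> g (ini (panel_groupoid \<W> s) h)"
    using orbit_chamber_eq_iff[OF ih c] by blast
  let ?e = "panel_action \<W> \<phi> \<psi> s g h"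
  have "?e \<in> Arr (panel_groupoid \<W> s)" "ini (panel_groupoid \<W> s) ?e = c"
    using panel_action_props[OF s g(1) h(1)] g by auto
  moreover from this have "A = orbit G (panel_action \<W> \<phi> \<psi> s) ?e"
    using orbit_panel_action_eq_iff[OF s h(1), of ?e] g h by blast
  ultimately show ?thesis using that by blast
qed

text \<open>On representatives chosen to be composable, each law is the image of the law in the
  panel groupoid. Freeness enters through \<open>quotient_comp\<close>: two such representatives
  stay composable only when translated by the same group element.\<close>

lemma groupoid_quotient:
  assumes free: "chamber_free G \<W> \<phi>" and s: "s \<in> S"
  shows "groupoid (panel_groupoid (weyl_quotient G \<W> \<phi> \<psi>) s)"
proof -
  interpret P: groupoid "panel_groupoid \<W> s" using panel_groupoid s .
  let ?\<Gamma> = "panel_groupoid \<W> s" and ?Q = "panel_groupoid (weyl_quotient G \<W> \<phi> \<psi>) s"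
  let ?o = "orbit G (panel_action \<W> \<phi> \<psi> s)"
  have V: "Vert ?\<Gamma> = chambers \<W>" using panel_vertices s .
  have ch: "ini ?\<Gamma> e \<in> chambers \<W>" "ter ?\<Gamma> e \<in> chambers \<W>" if "e \<in> Arr ?\<Gamma>" for e
    using P.ini_in P.ter_in V that by auto
  note q = quotient_ini[OF s] quotient_ter[OF s] quotient_id[OF s] quotient_inv[OF s]
    quotient_comp[OF free s]
  have next_rep: "\<exists>h \<in> Arr ?\<Gamma>. B = ?o h \<and> ini ?\<Gamma> h = ter ?\<Gamma> e"
    if "e \<in> Arr ?\<Gamma>" "B \<in> Arr ?Q" "ter ?Q (?o e) = ini ?Q B" for e B
    using quotient_arrow_representative[OF s ch(2)[OF that(1)] that(2)] that q by metis
  show ?thesis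
  proof
    show "Vert ?Q \<noteq> {}" using P.nonempty by (simp add: Vert_quotient[OF s] V)
  next
    fix A assume "A \<in> Arr ?Q"
    then obtain e where e: "e \<in> Arr ?\<Gamma>" "A = ?o e" by (auto simp: Arr_quotient)
    show "ini ?Q A \<in> Vert ?Q" "ter ?Q A \<in> Vert ?Q"
      using e ch by (auto simp: q Vert_quotient[OF s])
    show "gcomp ?Q (gid ?Q (ini ?Q A)) A = A" "gcomp ?Q A (gid ?Q (ter ?Q A)) = A"
      using e ch by (simp_all add: q V P.id_in P.ini_id P.ter_id P.id_left P.id_right)
    show "ginv ?Q A \<in> Arr ?Q" using e by (auto simp: q Arr_quotient P.inv_in)
    show "ini ?Q (ginv ?Q A) = ter ?Q A" "ter ?Q (ginv ?Q A) = ini ?Q A"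
      "gcomp ?Q A (ginv ?Q A) = gid ?Q (ini ?Q A)" "gcomp ?Q (ginv ?Q A) A = gid ?Q (ter ?Q A)"
      using e ch by (simp_all add: q P.inv_in P.ini_inv P.ter_inv P.inv_left P.inv_right)
  next
    fix A B assume AB: "A \<in> Arr ?Q" "B \<in> Arr ?Q" "ter ?Q A = ini ?Q B"
    then obtain e where e: "e \<in> Arr ?\<Gamma>" "A = ?o e" by (auto simp: Arr_quotient)
    then obtain h where "h \<in> Arr ?\<Gamma>" "B = ?o h" "ini ?\<Gamma> h = ter ?\<Gamma> e"
      using next_rep AB by blast
    with e show "gcomp ?Q A B \<in> Arr ?Q" "ini ?Q (gcomp ?Q A B) = ini ?Q A"
      "ter ?Q (gcomp ?Q A B) = ter ?Q B"
      by (simp_all add: q Arr_quotient P.comp_in P.ini_comp P.ter_comp)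
  next
    fix A B C assume ABC: "A \<in> Arr ?Q" "B \<in> Arr ?Q" "C \<in> Arr ?Q"
      "ter ?Q A = ini ?Q B" "ter ?Q B = ini ?Q C"
    then obtain e where e: "e \<in> Arr ?\<Gamma>" "A = ?o e" by (auto simp: Arr_quotient)
    then obtain h where h: "h \<in> Arr ?\<Gamma>" "B = ?o h" "ini ?\<Gamma> h = ter ?\<Gamma> e"
      using next_rep ABC by blast
    then obtain k where "k \<in> Arr ?\<Gamma>" "C = ?o k" "ini ?\<Gamma> k = ter ?\<Gamma> h"
      using next_rep ABC by blast
    with e h show "gcomp ?Q (gcomp ?Q A B) C = gcomp ?Q A (gcomp ?Q B C)"
      by (simp add: q P.comp_in P.ini_comp P.ter_comp P.assoc)
  next
    fix v assume "v \<in> Vert ?Q"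
    then obtain c where c: "c \<in> chambers \<W>" "v = orbit G \<phi> c" by (auto simp: Vert_quotient[OF s])
    then show "gid ?Q v \<in> Arr ?Q" "ini ?Q (gid ?Q v) = v" "ter ?Q (gid ?Q v) = v"
      by (simp_all add: q Arr_quotient V P.id_in P.ini_id P.ter_id)
  qed
qed

text \<open>Translates of identities are identities, so an orbit cannot mix the two kinds of arrows.
  Since edges exclude identities, this is what lets edges of the quotient be represented by
  edges.\<close>

lemma orbit_identity_iff:
  assumes s: "s \<in> S" and e: "e \<in> Arr (panel_groupoid \<W> s)"
  shows "orbit G (panel_action \<W> \<phi> \<psi> s) e \<in> gid (panel_groupoid (weyl_quotient G \<W> \<phi> \<psi>) s)
      ` Vert (panel_groupoid (weyl_quotient G \<W> \<phi> \<psi>) s)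
    \<longleftrightarrow> e \<in> gid (panel_groupoid \<W> s) ` Vert (panel_groupoid \<W> s)"
proof -
  interpret P: groupoid "panel_groupoid \<W> s" using panel_groupoid s .
  let ?\<Gamma> = "panel_groupoid \<W> s"
  have V: "Vert ?\<Gamma> = chambers \<W>" using panel_vertices s .
  have "e \<in> gid ?\<Gamma> ` chambers \<W>"
    if c: "c \<in> chambers \<W>"
      and eq: "orbit G (panel_action \<W> \<phi> \<psi> s) (gid ?\<Gamma> c) = orbit G (panel_action \<W> \<phi> \<psi> s) e" for c
  proof -
    have "gid ?\<Gamma> c \<in> Arr ?\<Gamma>" using c V P.id_in by simp
    then obtain g where "g \<in> carrier G" "e = panel_action \<W> \<phi> \<psi> s g (gid ?\<Gamma> c)"
      using orbit_panel_action_eq_iff[OF s _ e] eq by blast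
    then show ?thesis using panel_action_id[OF s _ c] chamber_in c by blast
  qed
  then show ?thesis
    using quotient_id[OF s] by (force simp: Vert_quotient[OF s] V image_image)
qed

section \<open>The quotient map as a covering\<close>

lemma edges_quotient:
  "edges S (weyl_quotient G \<W> \<phi> \<psi>) = quotient_edge_map G \<W> \<phi> \<psi> ` edges S \<W>"
  using orbit_identity_iff
  by (force simp: edges_def quotient_edge_map_def Arr_quotient image_iff)

lemma chamber_system_morphism_quotient:
  assumes free: "chamber_free G \<W> \<phi>"
  shows "chamber_system_morphism S \<W> (weyl_quotient G \<W> \<phi> \<psi>)
    (quotient_chamber_map G \<phi>) (quotient_edge_map G \<W> \<phi> \<psi>)"
proof -
  have "quotient_edge_map G \<W> \<phi> \<psi> i \<in> edges S (weyl_quotient G \<W> \<phi> \<psi>)" if "i \<in> edges S \<W>" for i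
    using that edges_quotient by blast
  then show ?thesis
    unfolding chamber_system_morphism_def
    by (auto simp: chambers_quotient quotient_chamber_map_def quotient_edge_map_def edges_def
        edge_ini_def edge_ter_def edge_inv_def edge_comp_def
        quotient_ini quotient_ter quotient_inv quotient_comp[OF free])
qed

lemma surjective_etale_quotient:
  assumes free: "chamber_free G \<W> \<phi>"
  shows "surjective_etale S \<W> (weyl_quotient G \<W> \<phi> \<psi>)
    (quotient_chamber_map G \<phi>) (quotient_edge_map G \<W> \<phi> \<psi>)"
  unfolding surjective_etale_def
proof (intro conjI ballI)
  let ?p = "quotient_chamber_map G \<phi>" and ?p' = "quotient_edge_map G \<W> \<phi> \<psi>"
  let ?Q = "weyl_quotient G \<W> \<phi> \<psi>"
  show "chamber_system_morphism S \<W> ?Q ?p ?p'"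
    by (rule chamber_system_morphism_quotient[OF free])
  show "?p ` chambers \<W> = chambers ?Q"
    by (auto simp: chambers_quotient quotient_chamber_map_def)
  fix c assume c: "c \<in> chambers \<W>"
  show "bij_betw ?p' (edges_from S \<W> c) (edges_from S ?Q (?p c))"
    unfolding bij_betw_def
  proof
    show "inj_on ?p' (edges_from S \<W> c)"
    proof (rule inj_onI)
      fix i j assume ij: "i \<in> edges_from S \<W> c" "j \<in> edges_from S \<W> c" "?p' i = ?p' j"
      then obtain s e h where e: "i = (s, e)" "j = (s, h)" "s \<in> S" "e \<in> Arr (panel_groupoid \<W> s)"
        "h \<in> Arr (panel_groupoid \<W> s)" "ini (panel_groupoid \<W> s) e = c" "ini (panel_groupoid \<W> s) h = c"
        "orbit G (panel_action \<W> \<phi> \<psi> s) e = orbit G (panel_action \<W> \<phi> \<psi> s) h"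
        by (cases i; cases j) (auto simp: edges_from_def edges_def edge_ini_def quotient_edge_map_def)
      then obtain g where g: "g \<in> carrier G" "h = panel_action \<W> \<phi> \<psi> s g e"
        using orbit_panel_action_eq_iff by blast
      \<comment> \<open>Both representatives start at \<open>c\<close>, so the group element
        relating them fixes \<open>c\<close> and freeness applies.\<close>
      then have "\<phi> g c = c" using panel_action_props(2)[OF e(3) g(1) e(4)] e by simp
      then have "g = \<one>" using free g c by (auto simp: chamber_free_def)
      then show "i = j" using e g panel_action_one by simp
    qed
    show "?p' ` edges_from S \<W> c = edges_from S ?Q (?p c)"
    proof
      show "?p' ` edges_from S \<W> c \<subseteq> edges_from S ?Q (?p c)"
        using chamber_system_morphism_edge[OF chamber_system_morphism_quotient[OF free]]
        by (auto simp: edges_from_def)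
      show "edges_from S ?Q (?p c) \<subseteq> ?p' ` edges_from S \<W> c"
      proof
        fix k assume k: "k \<in> edges_from S ?Q (?p c)"
        obtain s A where sA: "k = (s, A)" by (cases k)
        with k have s: "s \<in> S" and A: "A \<in> Arr (panel_groupoid ?Q s)"
          "ini (panel_groupoid ?Q s) A = orbit G \<phi> c"
          "A \<notin> gid (panel_groupoid ?Q s) ` Vert (panel_groupoid ?Q s)"
          by (auto simp: edges_from_def edges_def edge_ini_def quotient_chamber_map_def)
        obtain e where e: "e \<in> Arr (panel_groupoid \<W> s)" "A = orbit G (panel_action \<W> \<phi> \<psi> s) e"
          "ini (panel_groupoid \<W> s) e = c"
          using quotient_arrow_representative[OF s c A(1,2)] by blast
        then have "(s, e) \<in> edges_from S \<W> c"
          using orbit_identity_iff[OF s e(1)] A s by (simp add: edges_from_def edges_def edge_ini_def)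
        then show "k \<in> ?p' ` edges_from S \<W> c"
          using sA e by (force simp: quotient_edge_map_def)
      qed
    qed
  qed
qed

lemma generalized_chamber_system_quotient:
  assumes free: "chamber_free G \<W> \<phi>"
  shows "generalized_chamber_system S m (weyl_quotient G \<W> \<phi> \<psi>)"
proof (intro generalized_chamber_system.intro generalized_chamber_system_axioms.intro
    coxeter_matrix_axioms)
  fix s assume s: "s \<in> S"
  show "groupoid (panel_groupoid (weyl_quotient G \<W> \<phi> \<psi>) s)"
    by (rule groupoid_quotient[OF free s])
  show "Vert (panel_groupoid (weyl_quotient G \<W> \<phi> \<psi>) s) = chambers (weyl_quotient G \<W> \<phi> \<psi>)"
    by (simp add: Vert_quotient[OF s] chambers_quotient)
qed

text \<open>The candidate suites are images under the quotient map, which is already known to be a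
  morphism of chamber systems; that much preserves closedness and type, and it makes sense before
  the quotient is Weyl data.\<close>

lemma weyl_data_quotient:
  assumes free: "chamber_free G \<W> \<phi>"
  shows "weyl_data S m (weyl_quotient G \<W> \<phi> \<psi>)"
proof -
  interpret Q: generalized_chamber_system S m "weyl_quotient G \<W> \<phi> \<psi>"
    by (rule generalized_chamber_system_quotient[OF free])
  show ?thesis
  proof
    fix s t \<theta>
    assume "finite_pair S m s t" "\<theta> \<in> defining_suites (weyl_quotient G \<W> \<phi> \<psi>) s t"
    then show "st_cycle S m (weyl_quotient G \<W> \<phi> \<psi>) s t \<theta>"
      using defining_suites_cycles st_cycle_map[OF chamber_system_morphism_quotient[OF free]]
      by (auto simp: weyl_quotient_def)
  qed
qed

lemma defining_suite_quotient:
  "defining_suite S m (weyl_quotient G \<W> \<phi> \<psi>) \<theta> \<longleftrightarrow>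
    (\<exists>\<theta>'. defining_suite S m \<W> \<theta>'
      \<and> \<theta> = map_gallery (quotient_chamber_map G \<phi>) (quotient_edge_map G \<W> \<phi> \<psi>) \<theta>')"
  by (auto simp: defining_suite_def weyl_quotient_def)

lemma quotient_chamber_map_action:
  "g \<in> carrier G \<Longrightarrow> c \<in> chambers \<W> \<Longrightarrow> quotient_chamber_map G \<phi> (\<phi> g c) = quotient_chamber_map G \<phi> c"
  using orbit_chamber_eq_iff[of c "\<phi> g c"] chamber_in by (auto simp: quotient_chamber_map_def)

lemma quotient_edge_map_action:
  assumes "g \<in> carrier G" "i \<in> edges S \<W>"
  shows "quotient_edge_map G \<W> \<phi> \<psi> (\<psi> g i) = quotient_edge_map G \<W> \<phi> \<psi> i"
proof -
  obtain s e where i: "i = (s, e)" "s \<in> S" "e \<in> Arr (panel_groupoid \<W> s)"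
    using assms(2) by (auto simp: edges_def)
  have "\<psi> g i = (s, panel_action \<W> \<phi> \<psi> s g e)" using panel_action_nonid assms i by metis
  then show ?thesis
    using orbit_panel_action_eq_iff[OF i(2,3) panel_action_props(1)[OF i(2) assms(1) i(3)]] assms(1) i(1)
    by (auto simp: quotient_edge_map_def)
qed

lemma map_gallery_quotient_action:
  assumes "g \<in> carrier G" "gallery S \<W> \<beta>"
  shows "map_gallery (quotient_chamber_map G \<phi>) (quotient_edge_map G \<W> \<phi> \<psi>) (map_gallery (\<phi> g) (\<psi> g) \<beta>)
    = map_gallery (quotient_chamber_map G \<phi>) (quotient_edge_map G \<W> \<phi> \<psi>) \<beta>"
  using assms(2) edge_path_start[of "fst \<beta>" "snd \<beta>"] edge_path_edges[of S \<W> "fst \<beta>" "snd \<beta>"]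
    quotient_chamber_map_action[OF assms(1)] quotient_edge_map_action[OF assms(1)]
  by (auto simp: map_gallery_def gallery_def)

lemma weyl_covering_quotient:
  assumes free: "chamber_free G \<W> \<phi>"
  shows "weyl_covering S m \<W> (weyl_quotient G \<W> \<phi> \<psi>)
    (quotient_chamber_map G \<phi>) (quotient_edge_map G \<W> \<phi> \<psi>)"
  unfolding weyl_covering_def
proof (intro conjI allI impI)
  let ?p = "quotient_chamber_map G \<phi>" and ?p' = "quotient_edge_map G \<W> \<phi> \<psi>"
  let ?Q = "weyl_quotient G \<W> \<phi> \<psi>"
  interpret Q: weyl_data S m ?Q by (rule weyl_data_quotient[OF free])
  have W: "weyl_data S m \<W>" and W': "generalized_chamber_system S m \<W>" and Q: "weyl_data S m ?Q"
    by unfold_locales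
  note etale = surjective_etale_quotient[OF free]
  show "weyl_morphism S m \<W> ?Q ?p ?p'"
    unfolding weyl_morphism_def
    using W Q chamber_system_morphism_quotient[OF free] Q.defining_suite_is_suite
      defining_suite_quotient by blast
  show "surjective_etale S \<W> ?Q ?p ?p'" by fact
  fix \<beta> assume "gallery S \<W> \<beta> \<and> defining_suite S m ?Q (map_gallery ?p ?p' \<beta>)"
  then obtain \<theta> where \<beta>: "gallery S \<W> \<beta>" and \<theta>: "defining_suite S m \<W> \<theta>"
    and eq: "map_gallery ?p ?p' \<beta> = map_gallery ?p ?p' \<theta>"
    by (auto simp: defining_suite_quotient)
  have g\<theta>: "gallery S \<W> \<theta>" using defining_suite_gallery(1)[OF \<theta>] by (simp add: gallery_def)
  have ch: "fst \<beta> \<in> chambers \<W>" "fst \<theta> \<in> chambers \<W>"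
    using \<beta> g\<theta> edge_path_start by (auto simp: gallery_def)
  have "orbit G \<phi> (fst \<theta>) = orbit G \<phi> (fst \<beta>)"
    using eq by (simp add: map_gallery_def quotient_chamber_map_def)
  then obtain g where g: "g \<in> carrier G" "fst \<beta> = \<phi> g (fst \<theta>)"
    using orbit_chamber_eq_iff[OF ch(2,1)] by blast
  have "weyl_morphism S m \<W> \<W> (\<phi> g) (\<psi> g)"
    using automorphism[OF g(1)] by (simp add: weyl_automorphism_def weyl_isomorphism_def)
  \<comment> \<open>An automorphism need not permute the defining suites, so the translate of
    \<theta> is known only to be a suite, which is exactly what a covering asks of a lift.\<close>
  then have "suite S m \<W> (map_gallery (\<phi> g) (\<psi> g) \<theta>)"
    using \<theta> unfolding weyl_morphism_def by blast
  moreover have "\<beta> = map_gallery (\<phi> g) (\<psi> g) \<theta>"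
    using gallery_lift_unique[OF W' etale \<beta> gallery_map(1)[OF action_morphism[OF g(1)] g\<theta>]] g eq
      map_gallery_quotient_action[OF g(1) g\<theta>] by simp
  ultimately show "suite S m \<W> \<beta>" by simp
qed

end

theorem proposition4p23:
  fixes G :: "('g, 'z) monoid_scheme"
    and S :: "'s set" and m :: "'s \<Rightarrow> 's \<Rightarrow> enat"
    and \<W> :: "('s, 'c, 'e) weyl_struct"
    and \<phi> :: "'g \<Rightarrow> 'c \<Rightarrow> 'c" and \<psi> :: "'g \<Rightarrow> 's \<times> 'e \<Rightarrow> 's \<times> 'e"
  assumes "two_weyl_graph S m \<W>"
    and "weyl_action G S m \<W> \<phi> \<psi>"
    and "chamber_free G \<W> \<phi>"
  shows "two_weyl_graph S m (weyl_quotient G \<W> \<phi> \<psi>)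
    \<and> weyl_covering S m \<W> (weyl_quotient G \<W> \<phi> \<psi>)
        (quotient_chamber_map G \<phi>) (quotient_edge_map G \<W> \<phi> \<psi>)"
proof -
  interpret weyl_action G S m \<W> \<phi> \<psi> by fact
  show ?thesis
    using weyl_covering_quotient[OF assms(3)] two_weyl_graph_covered[OF _ assms(1)] by blast
qed

end
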